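(* Fix $1<p<\infty$ and suppose that $T$ is a linear operator acting on functions defined on $\mathbb{R}^n$. (a) Suppose there are $\lambda_0>0$ and an increasing function $\phi:[0,\lambda_0]\to[0,\infty)$ such that for each real-valued $b\in\mathcal{BMO}$ we have $$\|Tf\|_{L^p(e^{\lambda b})}\le\phi\big(|\lambda|\,\|b\|_{\mathcal{BMO}}\big)\,\|f\|_{L^p(e^{\lambda b})}\qquad\text{for all real }\lambda\text{ with }|\lambda|\le\frac{\lambda_0}{\|b\|_{\mathcal{BMO}}}.$$ Then, for each $k\ge0$ and each real-valued $b\in\mathcal{BMO}$, one has $$\|T_b^kf\|_{L^p(\mathbb{R}^n)}\le\phi(\lambda_0)\,k!\,\Big(\frac{p}{\lambda_0}\Big)^k\,\|b\|_{\mathcal{BMO}}^k\,\|f\|_{L^p(\mathbb{R}^n)}.$$ (b) Conversely, suppose that there exist $\lambda_0,C_0>0$ such that, for every real-valued $b\in\mathcal{BMO}$ and every $k\ge0$, one has $$\|T_b^kf\|_{L^p(\mathbb{R}^n)}\le C_0\,k!\,\Big(\frac{p}{\lambda_0}\Big)^k\,\|b\|_{\mathcal{BMO}}^k\,\|f\|_{L^p(\mathbb{R}^n)}.$$ Then there exists an increasing function $\phi:[0,\lambda_0)\to[0,\infty)$ such that for every real-valued $b\in\mathcal{BMO}$ we have $$\|Tf\|_{L^p(e^{\lambda b})}\le\phi\big(|\lambda|\,\|b\|_{\mathcal{BMO}}\big)\,\|f\|_{L^p(e^{\lambda b})}\qquad\text{for all real }\lambda\text{ with }|\lambda|<\fr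ac{\lambda_0}{\|b\|_{\mathcal{BMO}}}.$$
   Context: $\|f\|_{L^p(w)}=(\int_{\mathbb{R}^n}|f|^pw\,dx)^{1/p}$. $Q$ denotes cubes in $\mathbb{R}^n$ with sides parallel to the axes and $f_Q=\frac1{|Q|}\int_Qf\,dx$. $\|f\|_{\exp L,Q}:=\inf\{\lambda>0:\ \frac1{|Q|}\int_Qe^{|f|/\lambda}\,dx\le2\}$, and $\mathcal{BMO}$ is the space of locally integrable $b$ with $\|b\|_{\mathcal{BMO}}:=\sup_Q\|b-b_Q\|_{\exp L,Q}<\infty$. If $\|b\|_{\mathcal{BMO}}=0$, the restriction on $\lambda$ is void. Commutators (defined whenever they make sense): $T_b^0=T$, $T_b^1f=[T,b]f=T(bf)-b\,Tf$, and $T_b^k=[T_b^{k-1},b]$ for $k\ge2$; equivalently $T_b^kf(x)=T\big((b(\cdot)-b(x))^kf(\cdot)\big)(x)$. *)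

theory Defs
  imports "HOL-Analysis.Analysis"
begin

definition cubes :: "(real ^ 'n) set set" where
  "cubes = {cbox a (a + (\<chi> i. h)) | a h. 0 < h}"

definition average :: "(real ^ 'n \<Rightarrow> real) \<Rightarrow> (real ^ 'n) set \<Rightarrow> real" where
  "average f Q = (LINT x:Q|lebesgue. f x) / measure lebesgue Q"

(* Extended-valued: the infimum over the empty set is \<infinity>. *)
definition expL_norm :: "(real ^ 'n) set \<Rightarrow> (real ^ 'n \<Rightarrow> real) \<Rightarrow> ennreal" where
  "expL_norm Q f = (INF l \<in> {l. 0 < l \<and>
      (\<integral>\<^sup>+x\<in>Q. ennreal (exp (\<bar>f x\<bar> / l)) \<partial>lebesgue) / emeasure lebesgue Q \<le> 2}. ennreal l)"

definition locally_integrable :: "(real ^ 'n \<Rightarrow> real) \<Rightarrow> bool" where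
  "locally_integrable f \<longleftrightarrow> f \<in> borel_measurable lebesgue \<and>
     (\<forall>K. compact K \<longrightarrow> set_integrable lebesgue K f)"

definition bmo_enorm :: "(real ^ 'n \<Rightarrow> real) \<Rightarrow> ennreal" where
  "bmo_enorm b = (SUP Q \<in> cubes. expL_norm Q (\<lambda>x. b x - average b Q))"

definition BMO :: "(real ^ 'n \<Rightarrow> real) set" where
  "BMO = {b. locally_integrable b \<and> bmo_enorm b < \<infinity>}"

definition bmo_norm :: "(real ^ 'n \<Rightarrow> real) \<Rightarrow> real" where
  "bmo_norm b = enn2real (bmo_enorm b)"

definition Lp :: "real \<Rightarrow> (real ^ 'n \<Rightarrow> real) \<Rightarrow> (real ^ 'n \<Rightarrow> complex) set" where
  "Lp p w = {f \<in> borel_measurable lebesgue. integrable lebesgue (\<lambda>x. norm (f x) powr p * w x)}"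

definition Lp_norm :: "real \<Rightarrow> (real ^ 'n \<Rightarrow> real) \<Rightarrow> (real ^ 'n \<Rightarrow> complex) \<Rightarrow> real" where
  "Lp_norm p w f = (LINT x|lebesgue. norm (f x) powr p * w x) powr (1 / p)"

(* A linear operator with domain D, a linear space of measurable functions.  Images are only
   relevant up to null sets, so linearity is required almost everywhere.  Values of T outside D
   carry no meaning. *)
definition linear_operator_on ::
  "(real ^ 'n \<Rightarrow> complex) set \<Rightarrow> ((real ^ 'n \<Rightarrow> complex) \<Rightarrow> real ^ 'n \<Rightarrow> complex) \<Rightarrow> bool" where
  "linear_operator_on D T \<longleftrightarrow>
     D \<subseteq> borel_measurable lebesgue \<and>
     (\<lambda>x. 0) \<in> D \<and>
     (\<forall>f\<in>D. \<forall>g\<in>D. (\<lambda>x. f x + g x) \<in> D) \<and>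
     (\<forall>c. \<forall>f\<in>D. (\<lambda>x. c * f x) \<in> D) \<and>
     (\<forall>f\<in>D. T f \<in> borel_measurable lebesgue) \<and>
     (\<forall>f\<in>D. \<forall>g\<in>D. AE x in lebesgue. T (\<lambda>x. f x + g x) x = T f x + T g x) \<and>
     (\<forall>c. \<forall>f\<in>D. AE x in lebesgue. T (\<lambda>x. c * f x) x = c * T f x)"

primrec commutator ::
  "((real ^ 'n \<Rightarrow> complex) \<Rightarrow> real ^ 'n \<Rightarrow> complex) \<Rightarrow> (real ^ 'n \<Rightarrow> real) \<Rightarrow> nat \<Rightarrow>
   (real ^ 'n \<Rightarrow> complex) \<Rightarrow> real ^ 'n \<Rightarrow> complex" where
  "commutator T b 0 = T"
| "commutator T b (Suc k) =
     (\<lambda>f x. commutator T b k (\<lambda>y. of_real (b y) * f y) x - of_real (b x) * commutator T b k f x)"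

(* The functions f for which every term of commutator T b k f makes sense when T has domain D,
   i.e. b^j f \<in> D for all j \<le> k. *)
primrec commutator_dom ::
  "(real ^ 'n \<Rightarrow> complex) set \<Rightarrow> (real ^ 'n \<Rightarrow> real) \<Rightarrow> nat \<Rightarrow> (real ^ 'n \<Rightarrow> complex) set" where
  "commutator_dom D b 0 = D"
| "commutator_dom D b (Suc k) =
     {f \<in> commutator_dom D b k. (\<lambda>y. of_real (b y) * f y) \<in> commutator_dom D b k}"

definition Lp_bound_on ::
  "(real ^ 'n \<Rightarrow> complex) set \<Rightarrow> ((real ^ 'n \<Rightarrow> complex) \<Rightarrow> real ^ 'n \<Rightarrow> complex) \<Rightarrow>
   real \<Rightarrow> (real ^ 'n \<Rightarrow> real) \<Rightarrow> real \<Rightarrow> bool" where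
  "Lp_bound_on E S p w C \<longleftrightarrow> (\<forall>f \<in> E \<inter> Lp p w. S f \<in> Lp p w \<and> Lp_norm p w (S f) \<le> C * Lp_norm p w f)"

end

theory Submission
  imports Defs
begin

text \<open>Conjugating \<open>T\<close> with the multiplier \<open>exp (z b)\<close> gives the operators
  \<open>f \<mapsto> exp (- z b) T (exp (z b) f)\<close>, whose power series in \<open>z\<close> has the coefficients
  \<open>T\<^sub>b\<^sup>k f / k!\<close>, and whose norm on \<open>L\<^sup>p\<close> is the norm of \<open>T\<close> on the space with weight
  \<open>exp (- p Re z b)\<close>.  Cauchy estimates on a circle of radius \<open>\<lambda>\<^sub>0 / (p \<parallel>b\<parallel>)\<close> give (a), and summing
  the series gives (b).  Both are first carried out for \<open>f\<close> supported where \<open>b\<close> is bounded.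
  In (a) the functions \<open>b\<^sup>j f\<close> lie in no unweighted space, so the truncation is removed in the space
  with weight \<open>exp (- \<delta> \<bar>b\<bar>)\<close>, which is admissible because \<open>\<bar>b\<bar>\<close> is again in \<open>BMO\<close>.\<close>

section \<open>Weighted \<open>L\<^sup>p\<close> functionals\<close>

text \<open>Two obstacles shape the details. Linearity of \<open>T\<close> holds only almost
  everywhere, with a null set depending on the functions involved, and \<open>T\<close> is
  continuous only through the assumed bounds, so it cannot be applied termwise to an infinite sum.
  Instead the errors of the partial sums tend to 0 in norm, hence almost everywhere along a
  subsequence, and a pointwise growth bound identifies the limit. The null set outside which the
  power series holds also depends on \<open>z\<close>, so only countably many points of the circle
  are used at once; finite averages therefore stand in for a contour integral. The cut-off can be
  removed because the constants never involve the bound \<open>N\<close> of \<bar>b\<bar> on the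
  support of \<open>f\<close>: Fatou's lemma carries the estimate to the limit. In (b) a weighted
  space may contain functions outside the domain of \<open>T\<close>, so the estimate there concerns
  an extension of \<open>T\<close> by density. Norms enter as their p-th powers with values in
  [0, \<infinity>], which avoids integrability side conditions. A triangle inequality with a lossy
  constant is enough for limits; where constants matter, Jensen's inequality replaces it.\<close>

definition nnLp :: "'a measure \<Rightarrow> real \<Rightarrow> ('a \<Rightarrow> real) \<Rightarrow> ('a \<Rightarrow> complex) \<Rightarrow> ennreal" where
  "nnLp M p w f = (\<integral>\<^sup>+x. ennreal (norm (f x) powr p * w x) \<partial>M)"

lemma Lp_iff_nnLp:
  assumes "w \<in> borel_measurable lebesgue" and "\<And>x. 0 \<le> w x"
  shows "f \<in> Lp p w \<longleftrightarrow> f \<in> borel_measurable lebesgue \<and> nnLp lebesgue p w f < \<infinity>"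
  unfolding Lp_def nnLp_def integrable_iff_bounded
  using assms by (auto simp: abs_mult)

lemma Lp_norm_nnLp:
  assumes "f \<in> Lp p w" and "\<And>x. 0 \<le> w x" and "0 < p"
  shows "ennreal (Lp_norm p w f powr p) = nnLp lebesgue p w f"
proof -
  have "integrable lebesgue (\<lambda>x. norm (f x) powr p * w x)"
    using assms(1) by (simp add: Lp_def)
  then have "nnLp lebesgue p w f = ennreal (LINT x|lebesgue. norm (f x) powr p * w x)"
    unfolding nnLp_def by (rule nn_integral_eq_integral) (simp add: assms)
  moreover have "0 \<le> (LINT x|lebesgue. norm (f x) powr p * w x)"
    by (rule integral_nonneg_AE) (simp add: assms)
  ultimately show ?thesis
    using assms(3) by (simp add: Lp_norm_def powr_powr)
qed

lemma Lp_norm_nonneg: "0 \<le> Lp_norm p w f"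
  by (simp add: Lp_norm_def)

lemma Lp_bound_onI:
  assumes w: "w \<in> borel_measurable lebesgue" "\<And>x. 0 \<le> w x" and "0 < p" "0 \<le> C"
    and meas: "\<And>f. f \<in> E \<Longrightarrow> f \<in> Lp p w \<Longrightarrow> S f \<in> borel_measurable lebesgue"
    and le: "\<And>f. f \<in> E \<Longrightarrow> f \<in> Lp p w \<Longrightarrow>
      nnLp lebesgue p w (S f) \<le> ennreal (C powr p) * nnLp lebesgue p w f"
  shows "Lp_bound_on E S p w C"
  unfolding Lp_bound_on_def
proof (intro ballI conjI)
  fix f assume "f \<in> E \<inter> Lp p w"
  then have f: "f \<in> E" "f \<in> Lp p w" by auto
  have fin: "nnLp lebesgue p w f < \<infinity>"
    using f Lp_iff_nnLp[OF w] by blast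
  then have "nnLp lebesgue p w (S f) < \<infinity>"
    using le[OF f] by (metis ennreal_less_top ennreal_mult_less_top infinity_ennreal_def order_le_less_trans)
  then show S: "S f \<in> Lp p w"
    using meas[OF f] Lp_iff_nnLp[OF w] by blast
  have "ennreal (Lp_norm p w (S f) powr p) \<le> ennreal (C powr p) * ennreal (Lp_norm p w f powr p)"
    using le[OF f] by (simp only: Lp_norm_nnLp[OF S w(2) \<open>0 < p\<close>] Lp_norm_nnLp[OF f(2) w(2) \<open>0 < p\<close>])
  then have "Lp_norm p w (S f) powr p \<le> C powr p * Lp_norm p w f powr p"
    by (simp add: ennreal_mult[symmetric])
  also have "\<dots> = (C * Lp_norm p w f) powr p"
    using assms(4) by (simp add: powr_mult Lp_norm_nonneg)
  finally show "Lp_norm p w (S f) \<le> C * Lp_norm p w f"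
    using assms(3,4) by (meson Lp_norm_nonneg mult_nonneg_nonneg not_le powr_less_mono2)
qed

lemma Lp_bound_onD:
  assumes b: "Lp_bound_on E S p w C" and f: "f \<in> E" "f \<in> Lp p w"
    and w: "\<And>x. 0 \<le> w x" and "0 < p" "0 \<le> C"
  shows "S f \<in> Lp p w"
    and "nnLp lebesgue p w (S f) \<le> ennreal (C powr p) * nnLp lebesgue p w f"
proof -
  show S: "S f \<in> Lp p w"
    using b f by (auto simp: Lp_bound_on_def)
  have "Lp_norm p w (S f) \<le> C * Lp_norm p w f"
    using b f by (auto simp: Lp_bound_on_def)
  then have "Lp_norm p w (S f) powr p \<le> (C * Lp_norm p w f) powr p"
    using \<open>0 < p\<close> by (intro powr_mono2) (auto simp: Lp_norm_nonneg)
  also have "\<dots> = C powr p * Lp_norm p w f powr p"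
    using assms(6) by (simp add: powr_mult Lp_norm_nonneg)
  finally have "ennreal (Lp_norm p w (S f) powr p) \<le> ennreal (C powr p) * ennreal (Lp_norm p w f powr p)"
    by (simp add: ennreal_mult[symmetric])
  then show "nnLp lebesgue p w (S f) \<le> ennreal (C powr p) * nnLp lebesgue p w f"
    by (simp only: Lp_norm_nnLp[OF S w \<open>0 < p\<close>] Lp_norm_nnLp[OF f(2) w \<open>0 < p\<close>])
qed

lemma nnLp_cong_AE:
  assumes "AE x in M. f x = g x"
  shows "nnLp M p w f = nnLp M p w g"
  unfolding nnLp_def by (rule nn_integral_cong_AE) (use assms in auto)

lemma nnLp_mono:
  assumes "\<And>x. norm (f x) \<le> norm (g x)" and "\<And>x. 0 \<le> w x" and "0 \<le> p"
  shows "nnLp M p w f \<le> nnLp M p w g"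
  unfolding nnLp_def
  by (intro nn_integral_mono ennreal_leI mult_right_mono powr_mono2) (use assms in auto)

lemma nnLp_cmult:
  assumes [measurable]: "f \<in> borel_measurable M" "w \<in> borel_measurable M" and "\<And>x. 0 \<le> w x"
  shows "nnLp M p w (\<lambda>x. c * f x) = ennreal (norm c powr p) * nnLp M p w f"
  unfolding nnLp_def
  by (subst nn_integral_cmult[symmetric])
    (auto simp: norm_mult powr_mult assms(3) ennreal_mult[symmetric] mult.assoc)

lemma nnLp_bounded_mult:
  assumes "f \<in> borel_measurable M" "w \<in> borel_measurable M" and "\<And>x. 0 \<le> w x" and "0 \<le> p"
    and "\<And>x. norm (g x) \<le> c * norm (f x)" and "0 \<le> c"
  shows "nnLp M p w g \<le> ennreal (c powr p) * nnLp M p w f"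
proof -
  have "nnLp M p w g \<le> nnLp M p w (\<lambda>x. of_real c * f x)"
    by (intro nnLp_mono) (use assms in \<open>auto simp: norm_mult\<close>)
  then show ?thesis
    using assms by (simp add: nnLp_cmult)
qed

text \<open>Jensen's inequality for the power \<open>p\<close> with weights \<open>c k / s\<close>,
  multiplied by \<open>s powr p\<close>. The form without normalisation also covers total weight
  0.\<close>

lemma powr_sum_le:
  fixes c y :: "'i \<Rightarrow> real"
  assumes "finite K" and c: "\<And>k. k \<in> K \<Longrightarrow> 0 \<le> c k" and y: "\<And>k. k \<in> K \<Longrightarrow> 0 \<le> y k" and p: "1 \<le> p"
  shows "(\<Sum>k\<in>K. c k * y k) powr p \<le> (\<Sum>k\<in>K. c k) powr (p - 1) * (\<Sum>k\<in>K. c k * y k powr p)"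
proof -
  \<comment> \<open>Dropping the vanishing terms leaves positive points only and makes the total
    weight \<open>s\<close> positive as soon as anything is left.\<close>
  define L where "L = {k\<in>K. 0 < c k \<and> 0 < y k}"
  define s where "s = (\<Sum>k\<in>L. c k)"
  have finL: "finite L" and LK: "L \<subseteq> K" using assms(1) by (auto simp: L_def)
  have 1: "(\<Sum>k\<in>K. c k * y k) = (\<Sum>k\<in>L. c k * y k)"
    by (rule sum.mono_neutral_right) (use assms c y in \<open>auto simp: L_def less_le\<close>)
  have sle: "s \<le> (\<Sum>k\<in>K. c k)"
    unfolding s_def by (rule sum_mono2) (use assms LK in auto)
  have 2: "(\<Sum>k\<in>L. c k * y k powr p) \<le> (\<Sum>k\<in>K. c k * y k powr p)"
    by (rule sum_mono2) (use assms LK in auto)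
  show ?thesis
  proof (cases "L = {}")
    case True
    then show ?thesis using 1 p by (auto intro!: mult_nonneg_nonneg sum_nonneg c)
  next
    case False
    have s: "0 < s"
      unfolding s_def using finL False by (intro sum_pos) (auto simp: L_def)
    have "(\<Sum>k\<in>L. (c k / s) *\<^sub>R y k) powr p \<le> (\<Sum>k\<in>L. (c k / s) * y k powr p)"
      by (rule convex_on_sum[OF finL False powr_convex[OF p], where a = "\<lambda>k. c k / s"])
        (use s in \<open>auto simp: L_def s_def sum_divide_distrib[symmetric] sum_nonneg\<close>)
    then have "((\<Sum>k\<in>L. c k * y k) / s) powr p \<le> (\<Sum>k\<in>L. c k * y k powr p) / s"
      by (simp add: sum_divide_distrib)
    moreover have "((\<Sum>k\<in>L. c k * y k) / s) powr p = (\<Sum>k\<in>L. c k * y k) powr p / s powr p"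
      by (rule powr_divide)
    ultimately have "(\<Sum>k\<in>L. c k * y k) powr p \<le> s powr (p - 1) * (\<Sum>k\<in>L. c k * y k powr p)"
      using s by (simp add: powr_diff field_simps)
    also have "\<dots> \<le> (\<Sum>k\<in>K. c k) powr (p - 1) * (\<Sum>k\<in>K. c k * y k powr p)"
      using s sle p 2 by (intro mult_mono powr_mono2) (auto intro!: sum_nonneg simp: L_def)
    finally show ?thesis using 1 by simp
  qed
qed

text \<open>The substitute for Minkowski's inequality when all summands share one bound. Nothing is
  lost in the constant: a convex combination is again bounded by \<open>B\<close>, as averages in
  the Cauchy estimate require.\<close>

lemma nnLp_sum_le:
  assumes "finite K" and h: "\<And>k. k \<in> K \<Longrightarrow> h k \<in> borel_measurable M" and w: "w \<in> borel_measurable M"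
    and w0: "\<And>x. 0 \<le> w x" and p: "1 \<le> p" and c: "\<And>k. k \<in> K \<Longrightarrow> 0 \<le> c k"
    and B: "\<And>k. k \<in> K \<Longrightarrow> nnLp M p w (h k) \<le> B"
    and sle: "(\<Sum>k\<in>K. c k) \<le> C"
  shows "nnLp M p w (\<lambda>x. \<Sum>k\<in>K. of_real (c k) * h k x) \<le> ennreal (C powr p) * B"
proof -
  define s where "s = (\<Sum>k\<in>K. c k)"
  have s0: "0 \<le> s" unfolding s_def by (intro sum_nonneg c)
  have "norm (\<Sum>k\<in>K. of_real (c k) * h k x) powr p * w x
      \<le> (\<Sum>k\<in>K. s powr (p - 1) * c k * (norm (h k x) powr p * w x))" for x
  proof -
    have "norm (\<Sum>k\<in>K. of_real (c k) * h k x) \<le> (\<Sum>k\<in>K. c k * norm (h k x))"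
      by (rule order_trans[OF norm_sum]) (auto intro!: sum_mono simp: norm_mult c)
    then have "norm (\<Sum>k\<in>K. of_real (c k) * h k x) powr p \<le> (\<Sum>k\<in>K. c k * norm (h k x)) powr p"
      using p by (intro powr_mono2) auto
    also have "\<dots> \<le> s powr (p - 1) * (\<Sum>k\<in>K. c k * norm (h k x) powr p)"
      unfolding s_def by (rule powr_sum_le) (use assms in auto)
    finally have "norm (\<Sum>k\<in>K. of_real (c k) * h k x) powr p * w x
        \<le> s powr (p - 1) * (\<Sum>k\<in>K. c k * norm (h k x) powr p) * w x"
      by (rule mult_right_mono) (rule w0)
    then show ?thesis
      by (simp add: sum_distrib_left sum_distrib_right mult.assoc)
  qed
  then have "nnLp M p w (\<lambda>x. \<Sum>k\<in>K. of_real (c k) * h k x)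
      \<le> (\<integral>\<^sup>+x. ennreal (\<Sum>k\<in>K. s powr (p - 1) * c k * (norm (h k x) powr p * w x)) \<partial>M)"
    unfolding nnLp_def by (intro nn_integral_mono ennreal_leI)
  also have "\<dots> = (\<integral>\<^sup>+x. (\<Sum>k\<in>K. ennreal (s powr (p - 1) * c k) * ennreal (norm (h k x) powr p * w x)) \<partial>M)"
    by (intro nn_integral_cong) (simp add: sum_ennreal[symmetric] ennreal_mult c w0)
  also have "\<dots> = (\<Sum>k\<in>K. ennreal (s powr (p - 1) * c k) * nnLp M p w (h k))"
    unfolding nnLp_def using h w by (simp add: nn_integral_sum nn_integral_cmult)
  also have "\<dots> \<le> (\<Sum>k\<in>K. ennreal (s powr (p - 1) * c k) * B)"
    by (intro sum_mono mult_left_mono B) auto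
  also have "\<dots> = ennreal (\<Sum>k\<in>K. s powr (p - 1) * c k) * B"
    using c by (simp add: sum_distrib_right[symmetric] sum_ennreal)
  also have "(\<Sum>k\<in>K. s powr (p - 1) * c k) = s powr p"
  proof -
    have "(\<Sum>k\<in>K. s powr (p - 1) * c k) = s powr (p - 1) * s"
      by (simp add: s_def sum_distrib_left)
    then show ?thesis using s0 p by (cases "s = 0") (auto simp: powr_diff)
  qed
  also have "ennreal (s powr p) * B \<le> ennreal (C powr p) * B"
    using s0 sle p by (intro mult_right_mono ennreal_leI powr_mono2) (auto simp: s_def)
  finally show ?thesis .
qed

text \<open>The preceding bound with two weights 1 and the sum of both terms as common bound. The
  crude constant is harmless, since this is applied only to limits and to membership in
  \<open>Lp\<close>.\<close>

lemma nnLp_add_le: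
  assumes fg: "f \<in> borel_measurable M" "g \<in> borel_measurable M" and w: "w \<in> borel_measurable M"
    and w0: "\<And>x. 0 \<le> w x" and p: "1 \<le> p"
  shows "nnLp M p w (\<lambda>x. f x + g x) \<le> ennreal (2 powr p) * (nnLp M p w f + nnLp M p w g)"
proof -
  have "nnLp M p w (\<lambda>x. \<Sum>k\<in>{True,False}. of_real 1 * (if k then f x else g x))
      \<le> ennreal (2 powr p) * (nnLp M p w f + nnLp M p w g)"
  proof (rule nnLp_sum_le)
    show "nnLp M p w (\<lambda>x. if k then f x else g x) \<le> nnLp M p w f + nnLp M p w g" for k
      by (cases k) (auto simp: add_increasing add_increasing2)
    show "(\<lambda>x. if k then f x else g x) \<in> borel_measurable M" for k
      using fg by (cases k) auto
  qed (use assms in auto)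
  then show ?thesis by simp
qed

lemma nnLp_diff_le:
  assumes "f \<in> borel_measurable M" "g \<in> borel_measurable M" and "w \<in> borel_measurable M"
    and "\<And>x. 0 \<le> w x" and "1 \<le> p"
  shows "nnLp M p w (\<lambda>x. f x - g x) \<le> ennreal (2 powr p) * (nnLp M p w f + nnLp M p w g)"
proof -
  have "nnLp M p w (\<lambda>x. - g x) = nnLp M p w g" by (simp add: nnLp_def)
  then show ?thesis using nnLp_add_le[of f M "\<lambda>x. - g x" w p] assms by simp
qed

lemma nnLp_Fatou:
  assumes g: "\<And>n. g n \<in> borel_measurable M" and w: "w \<in> borel_measurable M" and "0 < p"
    and lim: "AE x in M. (\<lambda>n. g n x) \<longlonglongrightarrow> f x"
    and B: "\<And>n. n \<ge> N \<Longrightarrow> nnLp M p w (g n) \<le> B"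
  shows "nnLp M p w f \<le> B"
proof -
  have "AE x in M. ennreal (norm (f x) powr p * w x) = liminf (\<lambda>n. ennreal (norm (g n x) powr p * w x))"
    using lim
  proof eventually_elim
    case (elim x)
    have "(\<lambda>n. ennreal (norm (g n x) powr p * w x)) \<longlonglongrightarrow> ennreal (norm (f x) powr p * w x)"
      using elim \<open>0 < p\<close> by (intro tendsto_ennrealI tendsto_mult tendsto_powr' tendsto_norm tendsto_const) auto
    then show ?case by (simp add: lim_imp_Liminf)
  qed
  then have "nnLp M p w f = (\<integral>\<^sup>+x. liminf (\<lambda>n. ennreal (norm (g n x) powr p * w x)) \<partial>M)"
    unfolding nnLp_def by (rule nn_integral_cong_AE)
  also have "\<dots> \<le> liminf (\<lambda>n. nnLp M p w (g n))"
    unfolding nnLp_def using g w by (intro nn_integral_liminf) auto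
  also have "\<dots> \<le> B"
    by (rule Liminf_le) (use B in \<open>auto simp: eventually_sequentially\<close>)
  finally show ?thesis .
qed

lemma nnLp_eq_0_AE:
  assumes "f \<in> borel_measurable M" "w \<in> borel_measurable M" and "\<And>x. 0 < w x" and "nnLp M p w f = 0"
  shows "AE x in M. f x = 0"
proof -
  have "AE x in M. ennreal (norm (f x) powr p * w x) = 0"
    using assms(4) unfolding nnLp_def by (subst (asm) nn_integral_0_iff_AE) (use assms in auto)
  then show ?thesis
  proof eventually_elim
    case (elim x)
    then show ?case using assms(3)[of x] by (simp add: ennreal_eq_0_iff mult_le_0_iff)
  qed
qed

text \<open>After division by \<open>(2 * R) ^ j\<close> the p-th powers have integrals bounded by a
  geometric series of ratio \<open>(1/2) powr p\<close>. Their sum is therefore finite almost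
  everywhere, and it dominates each of its terms. The 2 could be any number above 1.\<close>

lemma nnLp_geometric_AE_bounded:
  assumes h[measurable]: "\<And>j. h j \<in> borel_measurable M" and [measurable]: "w \<in> borel_measurable M"
    and w0: "\<And>x. 0 < w x" and p: "0 < p" and "0 \<le> B" "0 < R"
    and le: "\<And>j. nnLp M p w (h j) \<le> ennreal (B * (R ^ j) powr p)"
  shows "AE x in M. \<exists>K. \<forall>j. norm (h j x) \<le> K * (2 * R) ^ j"
proof -
  define u where "u j x = ennreal (norm (h j x) powr p * w x) / ennreal (((2 * R) ^ j) powr p)" for j x
  have um[measurable]: "\<And>j. u j \<in> borel_measurable M" unfolding u_def by measurable
  have ui: "(\<integral>\<^sup>+x. u j x \<partial>M) \<le> ennreal (B * ((1/2) powr p) ^ j)" for j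
  proof -
    have "(\<integral>\<^sup>+x. u j x \<partial>M) = nnLp M p w (h j) / ennreal (((2 * R) ^ j) powr p)"
      unfolding u_def nnLp_def by (subst nn_integral_divide) auto
    also have "\<dots> \<le> ennreal (B * (R ^ j) powr p) / ennreal (((2 * R) ^ j) powr p)"
      by (intro divide_right_mono_ennreal le)
    also have "\<dots> = ennreal (B * (R ^ j) powr p / ((2 * R) ^ j) powr p)"
      using \<open>0 < R\<close> \<open>0 \<le> B\<close> by (intro divide_ennreal) auto
    also have "B * (R ^ j) powr p / ((2 * R) ^ j) powr p = B * ((1/2) powr p) ^ j"
      using \<open>0 < R\<close> by (simp add: powr_mult power_mult_distrib powr_power powr_powr powr_divide power_one_over)
        (simp add: powr_realpow[symmetric] powr_powr mult.commute divide_simps)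
    finally show ?thesis .
  qed
  have "summable (\<lambda>j. B * ((1/2) powr p) ^ j)"
    using p by (intro summable_mult summable_geometric) (use powr_less_mono2[of p "1/2" 1] in simp)
  then have s: "(\<Sum>j. ennreal (B * ((1/2) powr p) ^ j)) < \<infinity>"
    using \<open>0 \<le> B\<close> by (subst suminf_ennreal2) auto
  have "(\<integral>\<^sup>+x. (\<Sum>j. u j x) \<partial>M) = (\<Sum>j. (\<integral>\<^sup>+x. u j x \<partial>M))"
    by (rule nn_integral_suminf) measurable
  also have "\<dots> \<le> (\<Sum>j. ennreal (B * ((1/2) powr p) ^ j))"
    by (intro suminf_le ui) auto
  finally have "(\<integral>\<^sup>+x. (\<Sum>j. u j x) \<partial>M) \<noteq> \<infinity>" using s by auto
  then have "AE x in M. (\<Sum>j. u j x) \<noteq> \<infinity>"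
    by (intro nn_integral_PInf_AE) measurable
  then show ?thesis
  proof eventually_elim
    case (elim x)
    then obtain U where U: "(\<Sum>j. u j x) = ennreal U" "0 \<le> U"
      by (metis ennreal_cases infinity_ennreal_def)
    \<comment> \<open>\<open>U\<close> is the whole series at \<open>x\<close>; solving the bound on
      a single term for the norm gives this value of \<open>K\<close>, independent of
      \<open>j\<close>.\<close>
    have "norm (h j x) \<le> (U / w x) powr (1 / p) * (2 * R) ^ j" for j
    proof -
      have "u j x \<le> (\<Sum>j. u j x)"
        using sum_le_suminf[of "\<lambda>j. u j x" "{j}"] by auto
      then have "ennreal (norm (h j x) powr p * w x / ((2 * R) ^ j) powr p) \<le> ennreal U"
        unfolding U(1) using \<open>0 < R\<close> w0[of x] by (simp add: divide_ennreal u_def)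
      then have "norm (h j x) powr p * w x / ((2 * R) ^ j) powr p \<le> U"
        using U by simp
      then have "norm (h j x) powr p \<le> (U / w x) * ((2 * R) ^ j) powr p"
        using w0[of x] \<open>0 < R\<close> by (simp add: field_simps)
      then have "(norm (h j x) powr p) powr (1/p) \<le> ((U / w x) * ((2 * R) ^ j) powr p) powr (1/p)"
        using p by (intro powr_mono2) auto
      also have "\<dots> = (U / w x) powr (1/p) * (((2 * R) ^ j) powr p) powr (1/p)"
        by (rule powr_mult)
      finally show ?thesis
        using p \<open>0 < R\<close> by (simp add: powr_powr)
    qed
    then show ?case by blast
  qed
qed

text \<open>Along a subsequence the norms are at most \<open>(1/4) ^ j\<close>, and the preceding
  lemma with \<open>R = 1/4\<close> turns this into pointwise decay like \<open>(1/2) ^ j\<close>.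
  The finite index set provides one subsequence for all the terms of a commutator.\<close>

lemma nnLp_tendsto_0_AE_subseq:
  fixes g :: "'i \<Rightarrow> nat \<Rightarrow> 'a \<Rightarrow> complex"
  assumes g[measurable]: "\<And>i n. i \<in> I \<Longrightarrow> g i n \<in> borel_measurable M" and w[measurable]: "w \<in> borel_measurable M"
    and w0: "\<And>x. 0 < w x" and p: "0 < p" and I: "finite I"
    and lim: "\<And>i. i \<in> I \<Longrightarrow> (\<lambda>n. nnLp M p w (g i n)) \<longlonglongrightarrow> 0"
  obtains r :: "nat \<Rightarrow> nat" where "strict_mono r" "AE x in M. \<forall>i\<in>I. (\<lambda>n. g i (r n) x) \<longlonglongrightarrow> 0"
proof -
  have small: "\<forall>\<^sub>F n in sequentially. \<forall>i\<in>I. nnLp M p w (g i n) \<le> ennreal (((1/4) ^ j) powr p)" for j :: nat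
    unfolding eventually_ball_finite_distrib[OF I]
  proof
    fix i assume "i \<in> I"
    have "\<forall>\<^sub>F n in sequentially. nnLp M p w (g i n) < ennreal (((1/4) ^ j) powr p)"
      by (rule order_tendstoD(2)[OF lim[OF \<open>i \<in> I\<close>]]) simp
    then show "\<forall>\<^sub>F n in sequentially. nnLp M p w (g i n) \<le> ennreal (((1/4) ^ j) powr p)"
      by eventually_elim auto
  qed
  have "\<exists>r. strict_mono r \<and> (\<forall>j. \<forall>i\<in>I. nnLp M p w (g i (r j)) \<le> ennreal (((1/4) ^ j) powr p))"
  proof -
    have "\<exists>r. \<forall>j. (\<forall>i\<in>I. nnLp M p w (g i (r j)) \<le> ennreal (((1/4) ^ j) powr p)) \<and> r j < r (Suc j)"
    proof (rule dependent_nat_choice)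
      show "\<exists>n. \<forall>i\<in>I. nnLp M p w (g i n) \<le> ennreal (((1/4) ^ 0) powr p)"
        using small[of 0] by (auto simp: eventually_sequentially)
    next
      fix x n
      have "\<forall>\<^sub>F y in sequentially. (\<forall>i\<in>I. nnLp M p w (g i y) \<le> ennreal (((1/4) ^ Suc n) powr p)) \<and> x < y"
        using small[of "Suc n"] eventually_gt_at_top[of x] by eventually_elim auto
      then show "\<exists>y. (\<forall>i\<in>I. nnLp M p w (g i y) \<le> ennreal (((1/4) ^ Suc n) powr p)) \<and> x < y"
        by (auto simp: eventually_sequentially)
    qed
    then show ?thesis by (auto simp: strict_mono_Suc_iff)
  qed
  then obtain r where r: "strict_mono r"
    "\<And>j i. i \<in> I \<Longrightarrow> nnLp M p w (g i (r j)) \<le> ennreal (((1/4) ^ j) powr p)" by blast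
  have "AE x in M. (\<lambda>n. g i (r n) x) \<longlonglongrightarrow> 0" if i: "i \<in> I" for i
  proof -
    have "AE x in M. \<exists>K. \<forall>j. norm (g i (r j) x) \<le> K * (2 * (1/4)) ^ j"
      by (rule nnLp_geometric_AE_bounded[where B = 1 and w = w]) (use r i w0 p g w in auto)
    then show ?thesis
    proof eventually_elim
      case (elim x)
      then obtain K where K: "\<And>j. norm (g i (r j) x) \<le> K * (1/2) ^ j" by auto
      have "(\<lambda>j. K * (1/2) ^ j) \<longlonglongrightarrow> 0"
        by (rule tendsto_mult_right_zero) (rule LIMSEQ_realpow_zero, auto)
      then show ?case
        by (rule Lim_null_comparison[rotated]) (use K in simp)
    qed
  qed
  then have "AE x in M. \<forall>i\<in>I. (\<lambda>n. g i (r n) x) \<longlonglongrightarrow> 0"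
    using I by (simp add: AE_finite_all)
  with r(1) that show thesis by blast
qed

lemma nnLp_truncate_tendsto_0:
  assumes [measurable]: "f \<in> borel_measurable M" "w \<in> borel_measurable M" "\<And>n. A n \<in> sets M"
    and w0: "\<And>x. 0 \<le> w x" and "0 < p" and fin: "nnLp M p w f < \<infinity>"
    and ev: "\<And>x. \<forall>\<^sub>F n in sequentially. x \<in> A n"
  shows "(\<lambda>n. nnLp M p w (\<lambda>x. (if x \<in> A n then f x else 0) - f x)) \<longlonglongrightarrow> 0"
proof -
  have "(\<lambda>n. \<integral>\<^sup>+x. ennreal (norm ((if x \<in> A n then f x else 0) - f x) powr p * w x) \<partial>M)
      \<longlonglongrightarrow> (\<integral>\<^sup>+x. 0 \<partial>M)"
  proof (rule nn_integral_dominated_convergence[where w = "\<lambda>x. ennreal (norm (f x) powr p * w x)"])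
    show "AE x in M. (\<lambda>n. ennreal (norm ((if x \<in> A n then f x else 0) - f x) powr p * w x)) \<longlonglongrightarrow> 0"
    proof (rule AE_I2)
      fix x
      show "(\<lambda>n. ennreal (norm ((if x \<in> A n then f x else 0) - f x) powr p * w x)) \<longlonglongrightarrow> 0"
        by (rule tendsto_eventually) (use ev[of x] in eventually_elim, simp)
    qed
  qed (use fin w0 in \<open>auto simp: nnLp_def intro!: AE_I2 ennreal_leI mult_right_mono\<close>)
  then show ?thesis by (simp add: nnLp_def)
qed

text \<open>The Riesz-Fischer theorem for functions rather than classes: a subsequence with
  increments of norm at most \<open>(1/4) ^ j\<close> converges almost everywhere by
  telescoping.\<close>

lemma nnLp_complete:
  assumes g[measurable]: "\<And>n :: nat. g n \<in> borel_measurable M" and w[measurable]: "w \<in> borel_measurable M"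
    and w0: "\<And>x. 0 < w x" and p: "1 \<le> p"
    and cauchy: "\<And>e. 0 < e \<Longrightarrow> \<exists>N. \<forall>m\<ge>N. \<forall>n\<ge>N. nnLp M p w (\<lambda>x. g m x - g n x) \<le> ennreal e"
  obtains h where "h \<in> borel_measurable M" "(\<lambda>n. nnLp M p w (\<lambda>x. g n x - h x)) \<longlonglongrightarrow> 0"
proof -
  let ?P = "\<lambda>j N. \<forall>m\<ge>N. \<forall>n\<ge>N. nnLp M p w (\<lambda>x. g m x - g n x) \<le> ennreal (((1/4) ^ j) powr p)"
  have P: "\<exists>N. ?P j N" for j :: nat
    by (rule cauchy) simp
  have "\<exists>r. \<forall>j. ?P j (r j) \<and> r j < r (Suc j)"
  proof (rule dependent_nat_choice)
    show "\<exists>N. ?P 0 N" by (rule P)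
  next
    fix x n
    obtain N where "?P (Suc n) N" using P by blast
    then have "?P (Suc n) (max N (Suc x)) \<and> x < max N (Suc x)" by auto
    then show "\<exists>N. ?P (Suc n) N \<and> x < N" by blast
  qed
  then obtain r where r: "\<And>j. ?P j (r j)" "strict_mono r" by (auto simp: strict_mono_Suc_iff)
  \<comment> \<open>\<open>lim\<close> gives a measurable function without any convergence being
    known; its values matter only where the subsequence converges.\<close>
  define h where "h x = lim (\<lambda>j. g (r j) x)" for x
  have h[measurable]: "h \<in> borel_measurable M" unfolding h_def by measurable
  have "AE x in M. \<exists>K. \<forall>j. norm (g (r (Suc j)) x - g (r j) x) \<le> K * (2 * (1/4)) ^ j"
  proof (rule nnLp_geometric_AE_bounded[where B = 1 and w = w])
    show "nnLp M p w (\<lambda>x. g (r (Suc j)) x - g (r j) x) \<le> ennreal (1 * ((1/4) ^ j) powr p)" for j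
      using r(1)[of j] r(2) by (simp add: strict_mono_less_eq)
  qed (use w0 p in auto)
  then have lim: "AE x in M. (\<lambda>j. g (r j) x) \<longlonglongrightarrow> h x"
  proof eventually_elim
    case (elim x)
    then obtain K where K: "\<And>j. norm (g (r (Suc j)) x - g (r j) x) \<le> K * (1/2) ^ j" by auto
    have "summable (\<lambda>j. g (r (Suc j)) x - g (r j) x)"
      by (rule summable_comparison_test'[of "\<lambda>j. K * (1/2) ^ j" 0])
        (use K in \<open>auto intro!: summable_mult summable_geometric\<close>)
    then have "convergent (\<lambda>n. \<Sum>j<n. g (r (Suc j)) x - g (r j) x)"
      by (simp add: summable_iff_convergent)
    moreover have "(\<lambda>n. \<Sum>j<n. g (r (Suc j)) x - g (r j) x) = (\<lambda>n. g (r n) x - g (r 0) x)"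
      by (rule ext) (rule sum_lessThan_telescope)
    ultimately have "convergent (\<lambda>n. (g (r n) x - g (r 0) x) + g (r 0) x)"
      by (intro convergent_add convergent_const) simp
    then show ?case by (simp add: h_def convergent_LIMSEQ_iff)
  qed
  have "(\<lambda>n. nnLp M p w (\<lambda>x. g n x - h x)) \<longlonglongrightarrow> 0"
  proof (rule tendsto_zero_ennreal)
    fix e :: real assume "0 < e"
    then obtain N where N: "\<And>m n. m \<ge> N \<Longrightarrow> n \<ge> N \<Longrightarrow> nnLp M p w (\<lambda>x. g m x - g n x) \<le> ennreal (e/2)"
      using cauchy[of "e/2"] by auto
    \<comment> \<open>With \<open>n\<close> fixed, Fatou in \<open>j\<close> makes the Cauchy
      condition a bound on the distance to \<open>h\<close>, so the whole sequence converges and not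
      just the subsequence.\<close>
    have "nnLp M p w (\<lambda>x. g n x - h x) \<le> ennreal (e/2)" if n: "n \<ge> N" for n
    proof (rule nnLp_Fatou[where g = "\<lambda>j x. g n x - g (r j) x" and N = N])
      show "AE x in M. (\<lambda>j. g n x - g (r j) x) \<longlonglongrightarrow> g n x - h x"
        using lim by eventually_elim (intro tendsto_intros)
      show "nnLp M p w (\<lambda>x. g n x - g (r j) x) \<le> ennreal (e/2)" if "j \<ge> N" for j
        by (rule N[OF n]) (use that seq_suble[OF r(2), of j] in simp)
    qed (use p in auto)
    moreover have "ennreal (e/2) < ennreal e" using \<open>0 < e\<close> by (simp add: ennreal_lessI)
    ultimately show "\<forall>\<^sub>F n in sequentially. nnLp M p w (\<lambda>x. g n x - h x) < ennreal e"
      unfolding eventually_sequentially by (meson le_less_trans)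
  qed
  with h that show thesis by blast
qed

section \<open>Cauchy estimates\<close>

text \<open>The sum is geometric, and its ratio is an m-th root of unity different from 1, because
  \<open>n - k\<close> is nonzero and smaller than \<open>m\<close> in absolute value.\<close>

lemma average_roots_of_unity:
  fixes n k m :: nat
  assumes "k < m" "n < m" "n \<noteq> k"
  shows "(\<Sum>l<m. cis (- (2 * pi * l * k / m)) * cis (2 * pi * l / m) ^ n) = 0"
proof -
  define t where "t = 2 * pi * (real n - real k) / m"
  have m: "0 < m" using assms by simp
  have "cis (- (2 * pi * l * k / m)) * cis (2 * pi * l / m) ^ n = cis t ^ l" for l :: nat
  proof -
    have "- (2 * pi * l * k / m) + real n * (2 * pi * l / m) = real l * t"
      using m by (simp add: t_def field_simps)
    then show ?thesis by (simp only: Complex.DeMoivre cis_mult)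
  qed
  then have "(\<Sum>l<m. cis (- (2 * pi * l * k / m)) * cis (2 * pi * l / m) ^ n) = (\<Sum>l<m. cis t ^ l)"
    by simp
  moreover have "cis t ^ m = 1"
  proof -
    have "cis t ^ m = cis (2 * pi * of_int (int n - int k))"
      using m by (simp add: Complex.DeMoivre t_def)
    then show ?thesis by (simp only: cis_multiple_2pi Ints_of_int)
  qed
  moreover have "cis t \<noteq> 1"
  proof
    assume "cis t = 1"
    then have "cos t = 1" by (metis cis.sel(1) one_complex.sel(1))
    then obtain j :: int where "t = j * 2 * pi" by (auto simp: cos_one_2pi_int)
    then have "(2 * pi) * (real n - real k) = (2 * pi) * (of_int j * m)"
      using m by (simp add: t_def divide_simps mult_ac)
    then have "real n - real k = of_int j * m"
      by (subst (asm) mult_cancel_left) auto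
    then have "real_of_int (int n - int k) = of_int (j * int m)" by simp
    then have "int n - int k = j * int m" by (simp only: of_int_eq_iff)
    then have "int m dvd int n - int k" by simp
    moreover have "\<bar>int n - int k\<bar> < int m" "int n - int k \<noteq> 0" using assms by auto
    ultimately show False
      using dvd_imp_le_int[of "int n - int k" "int m"] by simp
  qed
  ultimately show ?thesis by (simp add: geometric_sum)
qed

text \<open>Averaging over the \<open>m\<close>-th roots of unity replaces the Cauchy integral: it picks out the
  \<open>k\<close>-th coefficient up to the terms of index at least \<open>m\<close>, and Jensen's inequality bounds
  the \<open>L\<^sup>p\<close> norm of a finite average.\<close>

lemma nnLp_Cauchy_estimate:
  fixes F :: "complex \<Rightarrow> 'a \<Rightarrow> complex" and a :: "nat \<Rightarrow> 'a \<Rightarrow> complex"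
  assumes F[measurable]: "\<And>z. F z \<in> borel_measurable M" and a[measurable]: "\<And>n. a n \<in> borel_measurable M"
    and w: "w \<in> borel_measurable M" "\<And>x. 0 \<le> w x" and p: "1 \<le> p" and e: "0 < e"
    and series: "\<And>z. AE x in M. (\<lambda>n. z ^ n * a n x) sums F z x"
    and B: "\<And>z. norm z = e \<Longrightarrow> nnLp M p w (F z) \<le> B"
  shows "nnLp M p w (a k) \<le> ennreal ((1 / e ^ k) powr p) * B"
proof -
  define u where "u m l = complex_of_real e * cis (2 * pi * real l / real m)" for m l :: nat
  define v where "v m l = cis (- (2 * pi * real l * real k / real m))" for m l :: nat
  define G where "G m x = (\<Sum>l<m. of_real (1 / m) * (v m l * F (u m l) x))" for m :: nat and x
  have Gm: "G m \<in> borel_measurable M" for m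
    unfolding G_def by measurable
  have GB: "nnLp M p w (G m) \<le> B" for m
  proof -
    have "nnLp M p w (G m) \<le> ennreal (1 powr p) * B"
      unfolding G_def
    proof (rule nnLp_sum_le)
      show "nnLp M p w (\<lambda>x. v m l * F (u m l) x) \<le> B" for l
      proof -
        have "nnLp M p w (\<lambda>x. v m l * F (u m l) x) = nnLp M p w (F (u m l))"
          by (simp add: nnLp_def norm_mult v_def)
        also have "\<dots> \<le> B" by (rule B) (use e in \<open>simp add: u_def norm_mult\<close>)
        finally show ?thesis .
      qed
    qed (use w p in auto)
    then show ?thesis by simp
  qed
  \<comment> \<open>All points \<open>u m l\<close> together are countable, so a single null set
    serves every average \<open>G m\<close>.\<close>
  have "AE x in M. \<forall>m l. (\<lambda>n. u m l ^ n * a n x) sums F (u m l) x"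
    unfolding AE_all_countable using series by blast
  then have lim: "AE x in M. (\<lambda>m. G m x) \<longlonglongrightarrow> of_real (e ^ k) * a k x"
    using series[of "of_real (2 * e)"]
  proof eventually_elim
    case (elim x)
    define s where "s n = e ^ n * norm (a n x)" for n
    \<comment> \<open>Convergence at the larger radius \<open>2 * e\<close> forces absolute
      convergence at radius \<open>e\<close>.\<close>
    have "summable (\<lambda>n. a n x * of_real (2 * e) ^ n)"
      using elim(2) by (simp add: sums_iff mult.commute)
    then have "summable (\<lambda>n. norm (a n x * of_real e ^ n))"
      by (rule powser_insidea) (use e in simp)
    then have s: "summable s"
      using e by (simp add: s_def[abs_def] norm_mult norm_power mult.commute)
    \<comment> \<open>The average multiplies the n-th term by a factor \<open>c n\<close>, which is
      1 at \<open>k\<close>, is 0 at the other indices below \<open>m\<close>, and has modulus at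
      most 1 beyond. Hence the error is at most a tail of the absolutely convergent series
      \<open>s\<close>.\<close>
    have bound: "norm (G m x - of_real (e ^ k) * a k x) \<le> suminf s - (\<Sum>n<m. s n)" if m: "k < m" for m
    proof -
      define c where "c n = (\<Sum>l<m. v m l * cis (2 * pi * real l / real m) ^ n) / of_nat m" for n
      have cle: "norm (c n) \<le> 1" for n
      proof -
        have "norm (\<Sum>l<m. v m l * cis (2 * pi * real l / real m) ^ n) \<le> (\<Sum>l<m. 1)"
          by (rule order_trans[OF norm_sum]) (simp add: v_def norm_mult norm_power)
        then show ?thesis using m by (simp add: c_def norm_divide)
      qed
      have c0: "c n = 0" if "n < m" "n \<noteq> k" for n
        unfolding c_def v_def using average_roots_of_unity[OF m that] by simp
      have c1: "c k = 1"
      proof -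
        have "v m l * cis (2 * pi * real l / real m) ^ k = 1" for l
          by (simp add: v_def Complex.DeMoivre cis_mult mult_ac)
        then show ?thesis using m by (simp add: c_def)
      qed
      have "(\<lambda>n. \<Sum>l<m. of_real (1 / m) * (v m l * (u m l ^ n * a n x))) sums G m x"
        unfolding G_def by (intro sums_sum sums_mult elim(1)[rule_format])
      moreover have "(\<Sum>l<m. of_real (1 / m) * (v m l * (u m l ^ n * a n x))) = of_real (e ^ n) * a n x * c n" for n
        by (simp add: c_def u_def power_mult_distrib sum_divide_distrib sum_distrib_left mult_ac)
      ultimately have "(\<lambda>n. of_real (e ^ n) * a n x * c n) sums G m x" by simp
      moreover have "(\<lambda>n. if n = k then of_real (e ^ k) * a k x else 0) sums (of_real (e ^ k) * a k x)"
        by (rule sums_single)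
      ultimately have "(\<lambda>n. of_real (e ^ n) * a n x * c n - (if n = k then of_real (e ^ k) * a k x else 0))
          sums (G m x - of_real (e ^ k) * a k x)" (is "?d sums _")
        by (rule sums_diff)
      then have "(\<lambda>n. ?d (n + m)) sums (G m x - of_real (e ^ k) * a k x - (\<Sum>n<m. ?d n))"
        by (rule sums_split_initial_segment)
      moreover have "(\<Sum>n<m. ?d n) = 0"
        by (rule sum.neutral) (auto simp: c0 c1)
      ultimately have eq: "G m x - of_real (e ^ k) * a k x = (\<Sum>n. ?d (n + m))"
        by (simp add: sums_iff)
      have "norm (\<Sum>n. ?d (n + m)) \<le> (\<Sum>n. s (n + m))"
      proof (rule norm_suminf_le)
        show "norm (?d (n + m)) \<le> s (n + m)" for n
          using cle[of "n + m"] e m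
          by (auto simp: s_def norm_mult norm_power intro!: mult_left_le)
        show "summable (\<lambda>n. s (n + m))" using s by (simp add: summable_iff_shift)
      qed
      then show ?thesis using eq suminf_minus_initial_segment[OF s, of m] by simp
    qed
    have tail: "(\<lambda>m. suminf s - (\<Sum>n<m. s n)) \<longlonglongrightarrow> suminf s - suminf s"
      by (intro tendsto_diff tendsto_const summable_LIMSEQ s)
    have "(\<lambda>m. G m x - of_real (e ^ k) * a k x) \<longlonglongrightarrow> 0"
    proof (rule Lim_null_comparison[rotated])
      show "\<forall>\<^sub>F m in sequentially. norm (G m x - of_real (e ^ k) * a k x) \<le> suminf s - (\<Sum>n<m. s n)"
        using eventually_gt_at_top[of k] by eventually_elim (rule bound)
    qed (use tail in simp)
    then show ?case by (rule LIM_zero_cancel)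
  qed
  have "nnLp M p w (\<lambda>x. of_real (e ^ k) * a k x) \<le> B"
    by (rule nnLp_Fatou[OF Gm w(1) _ lim GB]) (use p in simp)
  then have "ennreal ((1 / e ^ k) powr p) * nnLp M p w (\<lambda>x. of_real (e ^ k) * a k x)
      \<le> ennreal ((1 / e ^ k) powr p) * B"
    by (rule mult_left_mono) simp
  moreover have "nnLp M p w (\<lambda>x. of_real (1 / e ^ k) * (of_real (e ^ k) * a k x))
      = ennreal ((1 / e ^ k) powr p) * nnLp M p w (\<lambda>x. of_real (e ^ k) * a k x)"
    using w e by (subst nnLp_cmult) (auto simp: norm_divide norm_power)
  moreover have "(\<lambda>x. of_real (1 / e ^ k) * (of_real (e ^ k) * a k x)) = a k"
    using e by (simp add: fun_eq_iff)
  ultimately show ?thesis by simp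
qed

lemma nnLp_sums_le:
  assumes h: "\<And>k. h k \<in> borel_measurable M" and w: "w \<in> borel_measurable M" "\<And>x. 0 \<le> w x" and p: "1 \<le> p"
    and c: "\<And>k. 0 \<le> c k" "summable c"
    and B: "\<And>k. nnLp M p w (h k) \<le> B"
    and sums: "AE x in M. (\<lambda>k. of_real (c k) * h k x) sums F x"
  shows "nnLp M p w F \<le> ennreal (suminf c powr p) * B"
proof (rule nnLp_Fatou)
  show "AE x in M. (\<lambda>n. \<Sum>k<n. of_real (c k) * h k x) \<longlonglongrightarrow> F x"
    using sums by (simp add: sums_def)
  show "nnLp M p w (\<lambda>x. \<Sum>k<n. of_real (c k) * h k x) \<le> ennreal (suminf c powr p) * B" for n
    by (rule nnLp_sum_le) (use assms in \<open>auto intro!: sum_le_suminf\<close>)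
qed (use h w p in auto)

text \<open>The tails are compared term by term. The bound depends on \<open>r\<close> only, so it
  is uniform over a set where \<open>b\<close> is bounded.\<close>

lemma norm_exp_minus_partial_sum_le:
  fixes z :: complex
  assumes "norm z \<le> r"
  shows "norm (exp z - (\<Sum>j<n. z ^ j / fact j)) \<le> exp r - (\<Sum>j<n. r ^ j / fact j)"
proof -
  have z: "(\<lambda>j. z ^ j / fact j) sums exp z"
    using exp_converges[of z] by (simp add: scaleR_conv_of_real divide_inverse mult.commute)
  have r: "(\<lambda>j. r ^ j / fact j) sums exp r"
    using exp_converges[of r] by (simp add: divide_inverse mult.commute)
  have "exp z - (\<Sum>j<n. z ^ j / fact j) = (\<Sum>j. z ^ (j + n) / fact (j + n))"
    using suminf_minus_initial_segment[OF sums_summable[OF z], of n] sums_unique[OF z] by simp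
  moreover have "exp r - (\<Sum>j<n. r ^ j / fact j) = (\<Sum>j. r ^ (j + n) / fact (j + n))"
    using suminf_minus_initial_segment[OF sums_summable[OF r], of n] sums_unique[OF r] by simp
  moreover have "norm (\<Sum>j. z ^ (j + n) / fact (j + n)) \<le> (\<Sum>j. r ^ (j + n) / fact (j + n))"
  proof (rule norm_suminf_le)
    show "norm (z ^ (j + n) / fact (j + n)) \<le> r ^ (j + n) / fact (j + n)" for j
      using assms by (auto simp: norm_divide norm_power intro!: divide_right_mono power_mono)
    show "summable (\<lambda>j. r ^ (j + n) / fact (j + n))"
      using sums_summable[OF r] by (subst summable_iff_shift)
  qed
  ultimately show ?thesis by simp
qed

section \<open>Linear operators and commutators\<close>

lemma linear_operator_onD:
  assumes "linear_operator_on D T"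
  shows "f \<in> D \<Longrightarrow> f \<in> borel_measurable lebesgue"
    and "(\<lambda>x. 0) \<in> D"
    and "f \<in> D \<Longrightarrow> g \<in> D \<Longrightarrow> (\<lambda>x. f x + g x) \<in> D"
    and "f \<in> D \<Longrightarrow> (\<lambda>x. c * f x) \<in> D"
    and "f \<in> D \<Longrightarrow> T f \<in> borel_measurable lebesgue"
    and "f \<in> D \<Longrightarrow> g \<in> D \<Longrightarrow> AE x in lebesgue. T (\<lambda>x. f x + g x) x = T f x + T g x"
    and "f \<in> D \<Longrightarrow> AE x in lebesgue. T (\<lambda>x. c * f x) x = c * T f x"
  using assms unfolding linear_operator_on_def by blast+

lemma linear_operator_on_diff:
  assumes T: "linear_operator_on D T" and f: "f \<in> D" and g: "g \<in> D"
  shows "(\<lambda>x. f x - g x) \<in> D" "AE x in lebesgue. T (\<lambda>x. f x - g x) x = T f x - T g x"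
proof -
  note L = linear_operator_onD[OF T]
  have m: "(\<lambda>x. - 1 * g x) \<in> D" by (rule L(4)[OF g])
  show "(\<lambda>x. f x - g x) \<in> D" using L(3)[OF f m] by simp
  have "AE x in lebesgue. T (\<lambda>x. f x - g x) x = T f x + T (\<lambda>x. - 1 * g x) x"
    using L(6)[OF f m] by simp
  then show "AE x in lebesgue. T (\<lambda>x. f x - g x) x = T f x - T g x"
    using L(7)[OF g, of "- 1"] by eventually_elim simp
qed

lemma linear_operator_on_sum:
  assumes T: "linear_operator_on D T" and "finite I" and "\<And>i. i \<in> I \<Longrightarrow> h i \<in> D"
  shows "(\<lambda>x. \<Sum>i\<in>I. c i * h i x) \<in> D \<and>
    (AE x in lebesgue. T (\<lambda>x. \<Sum>i\<in>I. c i * h i x) x = (\<Sum>i\<in>I. c i * T (h i) x))"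
  using assms(2,3)
proof (induction I rule: finite_induct)
  case empty
  \<comment> \<open>That \<open>T\<close> of the zero function vanishes almost everywhere is
    homogeneity with factor 0.\<close>
  show ?case
    using linear_operator_onD(2)[OF T] linear_operator_onD(7)[OF T linear_operator_onD(2)[OF T], of 0]
    by simp
next
  case (insert i I)
  note L = linear_operator_onD[OF T]
  have h: "(\<lambda>x. c i * h i x) \<in> D" using insert by (intro L(4)) auto
  have S: "(\<lambda>x. \<Sum>i\<in>I. c i * h i x) \<in> D"
    "AE x in lebesgue. T (\<lambda>x. \<Sum>i\<in>I. c i * h i x) x = (\<Sum>i\<in>I. c i * T (h i) x)"
    using insert by auto
  have "AE x in lebesgue. T (\<lambda>x. c i * h i x) x = c i * T (h i) x"
    using insert by (intro L(7)) auto
  with L(6)[OF h S(1)] S(2)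
  have "AE x in lebesgue. T (\<lambda>x. c i * h i x + (\<Sum>i\<in>I. c i * h i x)) x = (\<Sum>i\<in>insert i I. c i * T (h i) x)"
    by eventually_elim (use insert in simp)
  then show ?case using L(3)[OF h S(1)] insert by simp
qed

lemma commutator_dom_iff:
  "f \<in> commutator_dom D b k \<longleftrightarrow> (\<forall>j\<le>k. (\<lambda>y. of_real (b y) ^ j * f y) \<in> D)"
proof (induction k arbitrary: f)
  case 0
  show ?case by simp
next
  case (Suc k)
  have eq: "(\<lambda>y. of_real (b y) ^ j * (of_real (b y) * f y)) = (\<lambda>y. of_real (b y) ^ Suc j * f y)" for j
    by (simp add: mult_ac)
  have "f \<in> commutator_dom D b (Suc k) \<longleftrightarrow>
      (\<forall>j\<le>k. (\<lambda>y. of_real (b y) ^ j * f y) \<in> D) \<and> (\<forall>j\<le>k. (\<lambda>y. of_real (b y) ^ Suc j * f y) \<in> D)"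
    by (simp add: Suc.IH eq[simplified])
  also have "\<dots> \<longleftrightarrow> (\<forall>j\<le>Suc k. (\<lambda>y. of_real (b y) ^ j * f y) \<in> D)"
  proof (intro iffI conjI allI impI; (elim conjE)?)
    fix j assume "\<forall>j\<le>k. (\<lambda>y. of_real (b y) ^ j * f y) \<in> D"
      "\<forall>j\<le>k. (\<lambda>y. of_real (b y) ^ Suc j * f y) \<in> D" "j \<le> Suc k"
    then show "(\<lambda>y. of_real (b y) ^ j * f y) \<in> D" by (cases j) auto
  qed (simp_all del: power_Suc)
  finally show ?case .
qed

text \<open>Pascal's rule in the shape of the recursion for commutators, with \<open>- b x\<close>
  for \<open>u\<close> and \<open>T\<close> of \<open>b^j f\<close> at \<open>x\<close> for
  \<open>c j\<close>.\<close>

lemma sum_choose_Suc: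
  fixes c :: "nat \<Rightarrow> complex"
  shows "(\<Sum>j\<le>Suc k. of_nat (Suc k choose j) * u ^ (Suc k - j) * c j)
    = (\<Sum>j\<le>k. of_nat (k choose j) * u ^ (k - j) * c (Suc j))
      + u * (\<Sum>j\<le>k. of_nat (k choose j) * u ^ (k - j) * c j)"
proof -
  have "u * (\<Sum>j\<le>k. of_nat (k choose j) * u ^ (k - j) * c j)
      = (\<Sum>j\<le>k. of_nat (k choose j) * u ^ (Suc k - j) * c j)"
    by (auto simp: sum_distrib_left Suc_diff_le mult_ac intro!: sum.cong)
  also have "\<dots> = (\<Sum>j\<le>Suc k. of_nat (k choose j) * u ^ (Suc k - j) * c j)"
    by simp
  also have "\<dots> = u ^ Suc k * c 0 + (\<Sum>j\<le>k. of_nat (k choose Suc j) * u ^ (k - j) * c (Suc j))"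
    by (subst sum.atMost_Suc_shift) simp
  finally show ?thesis
    by (subst sum.atMost_Suc_shift) (simp add: sum.distrib algebra_simps)
qed

text \<open>Unrolling the recursion at a fixed point \<open>x\<close>, where \<open>b x\<close> is a
  scalar, so no null set arises. This makes pointwise limits of commutators a matter of finitely
  many values of \<open>T\<close>.\<close>

lemma commutator_eq_sum:
  "commutator T b k f x =
    (\<Sum>j\<le>k. of_nat (k choose j) * (- of_real (b x)) ^ (k - j) * T (\<lambda>y. of_real (b y) ^ j * f y) x)"
proof (induction k arbitrary: f)
  case 0
  show ?case by simp
next
  case (Suc k)
  have eq: "(\<lambda>y. of_real (b y) ^ j * (of_real (b y) * f y)) = (\<lambda>y. of_real (b y) ^ Suc j * f y)" for j
    by (simp add: mult_ac)
  show ?case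
    unfolding sum_choose_Suc commutator.simps Suc.IH eq by simp
qed

section \<open>Absolute values in BMO\<close>

text \<open>Convexity of exp between 0 and \<open>t\<close>, here by Bernoulli. The number 6 is a
  convenient choice: exp(1/6) \<le> 6/5 cancels the factor 5/6 in the estimate below.\<close>

lemma exp_sixth_le: "exp (t / 6) \<le> 5 / 6 + exp t / 6" for t :: real
proof -
  have "1 + real 6 * (exp (t / 6) - 1) \<le> (1 + (exp (t / 6) - 1)) ^ 6"
    by (rule Bernoulli_inequality) simp
  also have "\<dots> = exp t" by (simp add: exp_of_nat_mult[symmetric])
  finally show ?thesis by simp
qed

lemma cubesD:
  assumes "Q \<in> cubes"
  shows "compact Q" "Q \<in> sets lebesgue" "emeasure lebesgue Q = ennreal (measure lebesgue Q)" "0 < measure lebesgue Q"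
proof -
  obtain a h where Q: "Q = cbox a (a + (\<chi> i. h))" and h: "0 < h"
    using assms by (auto simp: cubes_def)
  show c: "compact Q" by (simp add: Q)
  then have L: "Q \<in> lmeasurable" by (rule lmeasurable_compact)
  then show "Q \<in> sets lebesgue" by auto
  show "emeasure lebesgue Q = ennreal (measure lebesgue Q)"
    by (rule emeasure_eq_measure2[OF L])
  have "0 < measure lborel (cbox a (a + (\<chi> i. h)))"
    using h by (subst content_pos_lt_eq) (auto simp: Basis_vec_def inner_axis algebra_simps)
  then show "0 < measure lebesgue Q" by (simp add: Q measure_completion)
qed

text \<open>The average of \<bar>b\<bar> differs from the modulus of the average of \<open>b\<close>
  by at most \<open>l\<close>, so the oscillation of \<bar>b\<bar> is at most \<bar>b - average b
  Q\<bar> + \<open>l\<close>. Enlarging \<open>l\<close> six times absorbs the extra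
  \<open>l\<close>: the mean becomes at most 1 + 2/5.\<close>

lemma expL_average_abs:
  fixes b :: "real ^ 'n \<Rightarrow> real"
  assumes b: "locally_integrable b" and Q: "Q \<in> cubes" and l: "0 < l"
    and le: "(\<integral>\<^sup>+x\<in>Q. ennreal (exp (\<bar>b x - average b Q\<bar> / l)) \<partial>lebesgue) / emeasure lebesgue Q \<le> 2"
  shows "(\<integral>\<^sup>+x\<in>Q. ennreal (exp (\<bar>\<bar>b x\<bar> - average (\<lambda>x. \<bar>b x\<bar>) Q\<bar> / (6 * l))) \<partial>lebesgue) / emeasure lebesgue Q \<le> 2"
proof -
  note cQ = cubesD[OF Q]
  define m where "m = measure lebesgue Q"
  define a where "a = average b Q"
  have m: "0 < m" "emeasure lebesgue Q = ennreal m" using cQ by (auto simp: m_def)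
  have [measurable]: "b \<in> borel_measurable lebesgue" "Q \<in> sets lebesgue"
    using b cQ by (auto simp: locally_integrable_def)
  have ib: "set_integrable lebesgue Q b" using b cQ by (auto simp: locally_integrable_def)
  have const: "set_integrable lebesgue Q (\<lambda>x. c :: real)" for c
    using m by (simp add: set_integrable_def integrable_mult_left_iff integrable_indicator_iff)
  have iconst: "(LINT x:Q|lebesgue. c) = c * m" for c :: real
    by (simp add: set_lebesgue_integral_def m_def)
  have ig: "set_integrable lebesgue Q (\<lambda>x. b x - a)"
    using ib const by (rule set_integral_diff)
  have iag: "set_integrable lebesgue Q (\<lambda>x. \<bar>b x - a\<bar>)"
    using ig by (rule set_integrable_abs)
  have iab: "set_integrable lebesgue Q (\<lambda>x. \<bar>b x\<bar>)"
    using ib by (rule set_integrable_abs)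
  let ?E = "\<lambda>x. ennreal (exp (\<bar>b x - a\<bar> / l))"
  have E: "(\<integral>\<^sup>+x\<in>Q. ?E x \<partial>lebesgue) \<le> ennreal (2 * m)"
  proof -
    have "y \<le> ennreal (2 * m)" if "y / ennreal m \<le> ennreal 2" for y
      using that m(1) by (cases y) (auto simp: divide_ennreal field_simps ennreal_top_divide top_unique simp flip: ennreal_numeral)
    then show ?thesis using le unfolding m(2) a_def by simp
  qed
  \<comment> \<open>Averaging 1 + u \<le> exp u with u = \<bar>b - a\<bar> / l, where the
    exponential has mean at most 2, leaves a mean of at most 1 for u.\<close>
  have avg: "(LINT x:Q|lebesgue. \<bar>b x - a\<bar>) \<le> l * m"
  proof -
    have i2: "set_integrable lebesgue Q (\<lambda>x. 1 + \<bar>b x - a\<bar> / l)"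
      using const iag by (intro set_integral_add set_integrable_divide) auto
    have "ennreal (LINT x:Q|lebesgue. 1 + \<bar>b x - a\<bar> / l) = (\<integral>\<^sup>+x\<in>Q. ennreal (1 + \<bar>b x - a\<bar> / l) \<partial>lebesgue)"
      using i2 l unfolding set_lebesgue_integral_def set_integrable_def
      by (subst nn_integral_eq_integral[symmetric])
        (auto intro!: nn_integral_cong simp: indicator_def)
    also have "\<dots> \<le> (\<integral>\<^sup>+x\<in>Q. ?E x \<partial>lebesgue)"
      by (intro nn_integral_mono mult_right_mono ennreal_leI) (auto simp: exp_ge_add_one_self)
    also have "\<dots> \<le> ennreal (2 * m)" by (rule E)
    finally have "(LINT x:Q|lebesgue. 1 + \<bar>b x - a\<bar> / l) \<le> 2 * m" using m by simp
    moreover have "(LINT x:Q|lebesgue. 1 + \<bar>b x - a\<bar> / l) = m + (LINT x:Q|lebesgue. \<bar>b x - a\<bar>) / l"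
      using const iag iconst by (subst set_integral_add) (auto intro: set_integrable_divide)
    ultimately show ?thesis using l by (simp add: field_simps)
  qed
  have diff: "\<bar>average (\<lambda>x. \<bar>b x\<bar>) Q - \<bar>a\<bar>\<bar> \<le> l"
  proof -
    have "\<bar>(LINT x:Q|lebesgue. \<bar>b x\<bar>) - \<bar>a\<bar> * m\<bar> = \<bar>LINT x:Q|lebesgue. \<bar>b x\<bar> - \<bar>a\<bar>\<bar>"
      using iab const iconst by (subst set_integral_diff) auto
    also have "\<dots> \<le> (LINT x:Q|lebesgue. \<bar>b x - a\<bar>)"
    proof -
      have "set_integrable lebesgue Q (\<lambda>x. \<bar>b x\<bar> - \<bar>a\<bar>)"
        using iab const by (rule set_integral_diff)
      then show ?thesis
        using iag unfolding set_lebesgue_integral_def set_integrable_def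
        by (intro order_trans[OF integral_abs_bound] integral_mono) (auto simp: indicator_def)
    qed
    also have "\<dots> \<le> l * m" by (rule avg)
    finally have "\<bar>(LINT x:Q|lebesgue. \<bar>b x\<bar>) - \<bar>a\<bar> * m\<bar> / m \<le> l"
      using m by (simp add: field_simps)
    moreover have "\<bar>(LINT x:Q|lebesgue. \<bar>b x\<bar>) - \<bar>a\<bar> * m\<bar> / m = \<bar>average (\<lambda>x. \<bar>b x\<bar>) Q - \<bar>a\<bar>\<bar>"
      using m unfolding average_def m_def[symmetric]
      by (metis abs_div_pos diff_divide_distrib less_irrefl nonzero_mult_div_cancel_right)
    ultimately show ?thesis by simp
  qed
  have e6: "exp (1/6) \<le> (6/5 :: real)"
    using exp_bound[of "1/6"] by (simp add: power2_eq_square)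
  have pw: "exp (\<bar>\<bar>b x\<bar> - average (\<lambda>x. \<bar>b x\<bar>) Q\<bar> / (6 * l)) \<le> 1 + exp (\<bar>b x - a\<bar> / l) / 5" for x
  proof -
    have "\<bar>\<bar>b x\<bar> - average (\<lambda>x. \<bar>b x\<bar>) Q\<bar> \<le> \<bar>b x - a\<bar> + l"
      using diff by linarith
    then have "exp (\<bar>\<bar>b x\<bar> - average (\<lambda>x. \<bar>b x\<bar>) Q\<bar> / (6 * l)) \<le> exp ((\<bar>b x - a\<bar> + l) / (6 * l))"
      using l by (simp add: divide_right_mono)
    also have "(\<bar>b x - a\<bar> + l) / (6 * l) = 1/6 + (\<bar>b x - a\<bar> / l) / 6"
      using l by (simp add: field_simps)
    also have "exp (1/6 + (\<bar>b x - a\<bar> / l) / 6) = exp (1/6) * exp ((\<bar>b x - a\<bar> / l) / 6)"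
      by (rule exp_add)
    also have "\<dots> \<le> 6/5 * (5/6 + exp (\<bar>b x - a\<bar> / l) / 6)"
      by (intro mult_mono e6 exp_sixth_le) auto
    finally show ?thesis by simp
  qed
  have "(\<integral>\<^sup>+x\<in>Q. ennreal (exp (\<bar>\<bar>b x\<bar> - average (\<lambda>x. \<bar>b x\<bar>) Q\<bar> / (6 * l))) \<partial>lebesgue)
      \<le> (\<integral>\<^sup>+x. indicator Q x + ennreal (1/5) * (?E x * indicator Q x) \<partial>lebesgue)"
  proof (intro nn_integral_mono)
    fix x
    have "ennreal (exp (\<bar>\<bar>b x\<bar> - average (\<lambda>x. \<bar>b x\<bar>) Q\<bar> / (6 * l))) \<le> ennreal (1 + exp (\<bar>b x - a\<bar> / l) / 5)"
      by (intro ennreal_leI pw)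
    also have "\<dots> = 1 + ennreal (1/5) * ?E x"
      by (simp add: ennreal_mult[symmetric] ennreal_plus)
    finally show "ennreal (exp (\<bar>\<bar>b x\<bar> - average (\<lambda>x. \<bar>b x\<bar>) Q\<bar> / (6 * l))) * indicator Q x
        \<le> indicator Q x + ennreal (1/5) * (?E x * indicator Q x)"
      by (simp add: indicator_def)
  qed
  also have "\<dots> = ennreal m + ennreal (1/5) * (\<integral>\<^sup>+x\<in>Q. ?E x \<partial>lebesgue)"
    by (simp add: nn_integral_add nn_integral_cmult m)
  also have "\<dots> \<le> ennreal m + ennreal (1/5) * ennreal (2 * m)"
    by (intro add_left_mono mult_left_mono E) auto
  also have "\<dots> \<le> ennreal (2 * m)"
    using m by (simp add: ennreal_mult[symmetric] ennreal_plus[symmetric] del: ennreal_plus)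
  finally have "(\<integral>\<^sup>+x\<in>Q. ennreal (exp (\<bar>\<bar>b x\<bar> - average (\<lambda>x. \<bar>b x\<bar>) Q\<bar> / (6 * l))) \<partial>lebesgue) / ennreal m
      \<le> ennreal (2 * m) / ennreal m"
    by (rule divide_right_mono_ennreal)
  also have "\<dots> = 2" using m by (simp add: divide_ennreal)
  finally show ?thesis by (simp add: m)
qed

lemma abs_BMO:
  assumes "b \<in> BMO"
  shows "(\<lambda>x. \<bar>b x\<bar>) \<in> BMO"
proof -
  have b: "locally_integrable b" "bmo_enorm b < \<infinity>" using assms by (auto simp: BMO_def)
  \<comment> \<open>A number strictly above the norm yields an admissible \<open>l\<close> on every
    cube without any question of whether the infimum is attained.\<close>
  then obtain n where "bmo_enorm b < of_nat n"
    using ennreal_Ex_less_of_nat[of "bmo_enorm b"] by auto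
  then obtain c where c: "bmo_enorm b < ennreal c"
    by (metis ennreal_of_nat_eq_real_of_nat)
  have "expL_norm Q (\<lambda>x. \<bar>b x\<bar> - average (\<lambda>x. \<bar>b x\<bar>) Q) \<le> ennreal (6 * c)" if Q: "Q \<in> cubes" for Q
  proof -
    have "expL_norm Q (\<lambda>x. b x - average b Q) \<le> bmo_enorm b"
      unfolding bmo_enorm_def by (rule SUP_upper[OF Q])
    then have "expL_norm Q (\<lambda>x. b x - average b Q) < ennreal c"
      using c by (rule le_less_trans)
    then obtain l where l: "0 < l" "ennreal l < ennreal c"
      "(\<integral>\<^sup>+x\<in>Q. ennreal (exp (\<bar>b x - average b Q\<bar> / l)) \<partial>lebesgue) / emeasure lebesgue Q \<le> 2"
      unfolding expL_norm_def INF_less_iff by blast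
    then have "expL_norm Q (\<lambda>x. \<bar>b x\<bar> - average (\<lambda>x. \<bar>b x\<bar>) Q) \<le> ennreal (6 * l)"
      unfolding expL_norm_def
      by (intro INF_lower) (use expL_average_abs[OF b(1) Q l(1) l(3)] in auto)
    also have "\<dots> \<le> ennreal (6 * c)"
      using l by (intro ennreal_leI) (simp add: ennreal_less_iff)
    finally show ?thesis .
  qed
  then have "bmo_enorm (\<lambda>x. \<bar>b x\<bar>) \<le> ennreal (6 * c)"
    unfolding bmo_enorm_def by (rule SUP_least)
  then have "bmo_enorm (\<lambda>x. \<bar>b x\<bar>) < \<infinity>"
    using ennreal_less_top le_less_trans by (metis infinity_ennreal_def)
  moreover have "locally_integrable (\<lambda>x. \<bar>b x\<bar>)"
    using b by (auto simp: locally_integrable_def intro: set_integrable_abs)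
  ultimately show ?thesis by (simp add: BMO_def)
qed

lemma bmo_enorm_zero: "bmo_enorm (\<lambda>x::real^'n. 0) = 0"
proof -
  have "expL_norm Q (\<lambda>x::real^'n. 0 - average (\<lambda>x. 0) Q) \<le> ennreal e" if "0 < e" "Q \<in> cubes" for e Q
    unfolding expL_norm_def
  proof (rule INF_lower, intro CollectI conjI)
    have "(\<integral>\<^sup>+x\<in>Q. ennreal (exp (\<bar>0 - average (\<lambda>x. 0) Q\<bar> / e)) \<partial>lebesgue) = emeasure lebesgue Q"
      using cubesD(2)[OF that(2)] by (simp add: average_def set_lebesgue_integral_def del: emeasure_completion)
    then show "(\<integral>\<^sup>+x\<in>Q. ennreal (exp (\<bar>0 - average (\<lambda>x. 0) Q\<bar> / e)) \<partial>lebesgue) / emeasure lebesgue Q \<le> 2"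
      unfolding cubesD(3)[OF that(2)] using cubesD(4)[OF that(2)] by (simp add: divide_ennreal)
  qed fact
  then have le: "bmo_enorm (\<lambda>x::real^'n. 0) \<le> ennreal e" if "0 < e" for e
    unfolding bmo_enorm_def using that by (intro SUP_least)
  have "bmo_enorm (\<lambda>x::real^'n. 0) \<le> 0"
  proof (rule ennreal_le_epsilon)
    fix e :: real assume "0 < e"
    then show "bmo_enorm (\<lambda>x::real^'n. 0) \<le> 0 + ennreal e" unfolding add_0 by (rule le)
  qed
  then show ?thesis by (simp only: le_zero_eq)
qed

text \<open>For \<open>b = 0\<close> and \<open>l = 0\<close> the weight is 1, so the weighted
  hypothesis of (a) contains boundedness of \<open>T\<close> on the unweighted space.\<close>

lemma zero_BMO: "(\<lambda>x. 0) \<in> BMO"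
  by (simp add: BMO_def bmo_enorm_zero locally_integrable_def set_integrable_def)

lemma bmo_norm_zero: "bmo_norm (\<lambda>x. 0) = 0"
  by (simp add: bmo_norm_def bmo_enorm_zero)

section \<open>The power series of the conjugated operator\<close>

lemma squeeze_0_ennreal:
  fixes f a b :: "nat \<Rightarrow> ennreal"
  assumes "\<And>n. f n \<le> ennreal c * (a n + b n)" "a \<longlonglongrightarrow> 0" "b \<longlonglongrightarrow> 0"
  shows "f \<longlonglongrightarrow> 0"
proof -
  have "(\<lambda>n. ennreal c * (a n + b n)) \<longlonglongrightarrow> ennreal c * (0 + 0)"
    by (intro ennreal_tendsto_cmult tendsto_add assms) simp
  then show ?thesis
    by (intro tendsto_sandwich[of "\<lambda>_. 0" f sequentially "\<lambda>n. ennreal c * (a n + b n)" 0])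
      (use assms(1) in auto)
qed

section \<open>Stability of the weighted spaces under multipliers and sums\<close>

lemma Lp_bounded_mult:
  assumes w: "w \<in> borel_measurable lebesgue" "\<And>x. 0 \<le> w x" and p: "0 \<le> p"
    and f: "f \<in> Lp p w" and g: "g \<in> borel_measurable lebesgue"
    and le: "\<And>x. norm (g x) \<le> c * norm (f x)" and "0 \<le> c"
  shows "g \<in> Lp p w"
proof -
  note f' = f[unfolded Lp_iff_nnLp[OF w]]
  have "nnLp lebesgue p w g \<le> ennreal (c powr p) * nnLp lebesgue p w f"
    by (rule nnLp_bounded_mult) (use assms f' in auto)
  also have "\<dots> < \<infinity>" using f' by (simp add: ennreal_mult_less_top)
  finally show ?thesis using g Lp_iff_nnLp[OF w] by blast
qed

lemma Lp_measurable: "f \<in> Lp p w \<Longrightarrow> f \<in> borel_measurable lebesgue"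
  by (simp add: Lp_def)

lemma Lp_cmult:
  assumes "w \<in> borel_measurable lebesgue" "\<And>x. 0 \<le> w x" and "0 \<le> p" and "f \<in> Lp p w"
  shows "(\<lambda>x. c * f x) \<in> Lp p w"
  by (rule Lp_bounded_mult[OF assms, of _ "norm c"])
    (use Lp_measurable[OF assms(4)] in \<open>auto simp: norm_mult\<close>)

lemma Lp_add:
  assumes w: "w \<in> borel_measurable lebesgue" "\<And>x. 0 \<le> w x" and p: "1 \<le> p"
    and f: "f \<in> Lp p w" and g: "g \<in> Lp p w"
  shows "(\<lambda>x. f x + g x) \<in> Lp p w"
proof -
  note m = Lp_measurable[OF f] Lp_measurable[OF g]
  have "nnLp lebesgue p w (\<lambda>x. f x + g x) \<le> ennreal (2 powr p) * (nnLp lebesgue p w f + nnLp lebesgue p w g)"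
    by (rule nnLp_add_le[OF m w p])
  also have "\<dots> < \<infinity>"
    using f[unfolded Lp_iff_nnLp[OF w]] g[unfolded Lp_iff_nnLp[OF w]] by (simp add: ennreal_mult_less_top)
  finally show ?thesis
    using borel_measurable_add[OF m] by (simp add: Lp_iff_nnLp[OF w])
qed

lemma Lp_diff:
  assumes w: "w \<in> borel_measurable lebesgue" "\<And>x. 0 \<le> w x" and p: "1 \<le> p"
    and f: "f \<in> Lp p w" and g: "g \<in> Lp p w"
  shows "(\<lambda>x. f x - g x) \<in> Lp p w"
  using Lp_add[OF w p f Lp_cmult[OF w _ g, of "- 1"]] p by simp

text \<open>The isometry behind the conjugation. A complex exponent acts on the norm through its
  real part alone, which is why real weights control all complex \<open>z\<close>.\<close>

lemma nnLp_exp_weight: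
  "nnLp M p (\<lambda>x. w x * exp (p * Re (v x))) f = nnLp M p w (\<lambda>x. exp (v x) * f x)"
  unfolding nnLp_def
  by (intro nn_integral_cong) (simp add: norm_mult powr_mult exp_powr_real mult_ac)

lemma commutator_measurable:
  assumes T: "linear_operator_on D T" and f: "f \<in> commutator_dom D b k"
    and [measurable]: "b \<in> borel_measurable lebesgue"
  shows "commutator T b k f \<in> borel_measurable lebesgue"
proof -
  have [measurable]: "T (\<lambda>y. of_real (b y) ^ j * f y) \<in> borel_measurable lebesgue" if "j \<le> k" for j
    using f that linear_operator_onD(5)[OF T] by (simp add: commutator_dom_iff)
  have "(\<lambda>x. \<Sum>j\<le>k. of_nat (k choose j) * (- of_real (b x)) ^ (k - j) * T (\<lambda>y. of_real (b y) ^ j * f y) x)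
      \<in> borel_measurable lebesgue"
    by (intro borel_measurable_sum borel_measurable_times) (auto simp del: of_real_minus)
  then show ?thesis unfolding commutator_eq_sum[abs_def] .
qed

lemma Lp_power_mult:
  assumes w: "w \<in> borel_measurable lebesgue" "\<And>x. 0 \<le> w x" and p: "0 \<le> p"
    and f: "f \<in> Lp p w" and [measurable]: "b \<in> borel_measurable lebesgue"
    and bN: "\<And>x. f x \<noteq> 0 \<Longrightarrow> \<bar>b x\<bar> \<le> N" "0 \<le> N"
  shows "(\<lambda>y. of_real (b y) ^ j * f y) \<in> Lp p w"
proof (rule Lp_bounded_mult[OF w p f])
  have [measurable]: "f \<in> borel_measurable lebesgue" using f Lp_iff_nnLp[OF w] by blast
  show "(\<lambda>y. of_real (b y) ^ j * f y) \<in> borel_measurable lebesgue" by measurable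
  show "norm (of_real (b x) ^ j * f x) \<le> N ^ j * norm (f x)" for x
    using bN(1)[of x] by (cases "f x = 0") (auto simp: norm_mult norm_power intro!: mult_right_mono power_mono)
qed (use bN in auto)

lemma Lp_exp_mult:
  assumes w: "w \<in> borel_measurable lebesgue" "\<And>x. 0 \<le> w x" and p: "0 \<le> p"
    and f: "f \<in> Lp p w" and [measurable]: "b \<in> borel_measurable lebesgue"
    and bN: "\<And>x. f x \<noteq> 0 \<Longrightarrow> \<bar>b x\<bar> \<le> N"
  shows "(\<lambda>y. exp (z * of_real (b y)) * f y) \<in> Lp p w"
proof (rule Lp_bounded_mult[OF w p f])
  have [measurable]: "f \<in> borel_measurable lebesgue" using f Lp_iff_nnLp[OF w] by blast
  show "(\<lambda>y. exp (z * of_real (b y)) * f y) \<in> borel_measurable lebesgue" by measurable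
  show "norm (exp (z * of_real (b x)) * f x) \<le> exp (norm z * N) * norm (f x)" for x
  proof (cases "f x = 0")
    case False
    have "Re (z * of_real (b x)) \<le> norm z * N"
      by (rule order_trans[OF complex_Re_le_cmod])
        (use bN[OF False] in \<open>simp add: norm_mult mult_left_mono\<close>)
    then show ?thesis by (simp add: norm_mult mult_right_mono)
  qed simp
qed auto

text \<open>Boundedness of \<open>b\<close> on the support of \<open>f\<close> makes the exponential
  series for exp(z b) f converge in norm. Applying \<open>T\<close> and multiplying by exp(- z b(x))
  as a Cauchy product produces the binomial formula for the commutators as coefficients.\<close>

lemma commutator_power_series:
  fixes T :: "(real ^ 'n \<Rightarrow> complex) \<Rightarrow> real ^ 'n \<Rightarrow> complex"
  assumes T: "linear_operator_on D T" and LpD: "Lp p (\<lambda>x. 1) \<subseteq> D" and p: "1 \<le> p" and K: "0 \<le> K"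
    and bd: "\<And>g. g \<in> Lp p (\<lambda>x. 1) \<Longrightarrow>
      nnLp lebesgue p (\<lambda>x. 1) (T g) \<le> ennreal (K powr p) * nnLp lebesgue p (\<lambda>x. 1) g"
    and b[measurable]: "b \<in> borel_measurable lebesgue" and f: "f \<in> Lp p (\<lambda>x. 1)"
    and bN: "\<And>x. f x \<noteq> 0 \<Longrightarrow> \<bar>b x\<bar> \<le> N" and N: "0 < N"
  shows "AE x in lebesgue. (\<lambda>k. z ^ k * (commutator T b k f x / fact k)) sums
    (exp (- z * of_real (b x)) * T (\<lambda>y. exp (z * of_real (b y)) * f y) x)"
proof -
  let ?I = "nnLp lebesgue p (\<lambda>x::real^'n. 1)"
  have w1: "(\<lambda>x::real^'n. 1::real) \<in> borel_measurable lebesgue" "\<And>x. (0::real) \<le> 1" by auto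
  note L = linear_operator_onD[OF T]
  define B where "B j = (\<lambda>y. of_real (b y) ^ j * f y)" for j
  define E where "E = (\<lambda>y. exp (z * of_real (b y)) * f y)"
  define r where "r = norm z * N"
  define e where "e J = exp r - (\<Sum>j<J. r ^ j / fact j)" for J
  have fm[measurable]: "f \<in> borel_measurable lebesgue" and ffin: "?I f < \<infinity>"
    using f Lp_iff_nnLp[OF w1] by auto
  obtain F where F: "?I f = ennreal F" "0 \<le> F" using ffin by (cases "?I f") auto
  have BL: "B j \<in> Lp p (\<lambda>x. 1)" for j
    unfolding B_def by (rule Lp_power_mult[OF w1 _ f b bN]) (use N p in auto)
  have EL: "E \<in> Lp p (\<lambda>x. 1)"
    unfolding E_def by (rule Lp_exp_mult[OF w1 _ f b bN]) (use p in auto)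
  have BD: "B j \<in> D" and ED: "E \<in> D" for j using BL EL LpD by auto
  have TB[measurable]: "T (B j) \<in> borel_measurable lebesgue" for j by (rule L(5)[OF BD])
  have TE[measurable]: "T E \<in> borel_measurable lebesgue" by (rule L(5)[OF ED])
  \<comment> \<open>The norm of \<open>T (B j)\<close> grows at most like \<open>N ^ j\<close>,
    hence its values grow geometrically at almost every point, and the factorials make the series in
    \<open>z\<close> absolutely convergent there.\<close>
  have "AE x in lebesgue. \<exists>C. \<forall>j. norm (T (B j) x) \<le> C * (2 * N) ^ j"
  proof (rule nnLp_geometric_AE_bounded[where B = "K powr p * F"])
    fix j
    have "?I (T (B j)) \<le> ennreal (K powr p) * ?I (B j)" by (rule bd[OF BL])
    also have "?I (B j) \<le> ennreal ((N ^ j) powr p) * ?I f"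
    proof (rule nnLp_bounded_mult)
      show "norm (B j x) \<le> N ^ j * norm (f x)" for x
        using bN[of x] by (cases "f x = 0") (auto simp: B_def norm_mult norm_power intro!: mult_right_mono power_mono)
    qed (use p N in auto)
    also have "ennreal (K powr p) * (ennreal ((N ^ j) powr p) * ?I f) = ennreal (K powr p * F * (N ^ j) powr p)"
      using F by (simp add: ennreal_mult[symmetric] mult_ac)
    finally show "?I (T (B j)) \<le> ennreal (K powr p * F * (N ^ j) powr p)" by (simp add: mult_left_mono)
  qed (use p N F in auto)
  moreover
  define S where "S J = (\<lambda>x. \<Sum>j\<in>{..<J}. (z ^ j / fact j) * B j x)" for J
  have SD: "S J \<in> D" "AE x in lebesgue. T (S J) x = (\<Sum>j<J. (z ^ j / fact j) * T (B j) x)" for J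
    using linear_operator_on_sum[OF T, of "{..<J}" B "\<lambda>j. z ^ j / fact j"] BD by (auto simp: S_def)
  have Sm[measurable]: "S J \<in> borel_measurable lebesgue" for J by (rule L(1)[OF SD(1)])
  have Em[measurable]: "E \<in> borel_measurable lebesgue" by (rule L(1)[OF ED])
  have e0: "0 \<le> e J" for J
    unfolding e_def
    by (rule order_trans[OF norm_ge_zero norm_exp_minus_partial_sum_le[of "of_real r"]]) (use N in \<open>simp add: r_def norm_mult\<close>)
  have err: "norm (E x - S J x) \<le> e J * norm (f x)" for x J
  proof (cases "f x = 0")
    case False
    have "norm (z * of_real (b x)) \<le> r"
      using bN[OF False] by (auto simp: r_def norm_mult intro: mult_left_mono)
    from norm_exp_minus_partial_sum_le[OF this, of J]
    have "norm (exp (z * of_real (b x)) - (\<Sum>j<J. (z * of_real (b x)) ^ j / fact j)) * norm (f x) \<le> e J * norm (f x)"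
      unfolding e_def by (rule mult_right_mono) simp
    moreover have "E x - S J x = (exp (z * of_real (b x)) - (\<Sum>j<J. (z * of_real (b x)) ^ j / fact j)) * f x"
      by (simp add: E_def S_def B_def left_diff_distrib sum_distrib_right power_mult_distrib mult.assoc)
    ultimately show ?thesis by (simp add: norm_mult)
  qed (auto simp: E_def S_def B_def)
  have diffL: "(\<lambda>x. E x - S J x) \<in> Lp p (\<lambda>x. 1)" for J
    by (rule Lp_bounded_mult[OF w1 _ f _ err e0]) (use p in auto)
  have diffD: "AE x in lebesgue. T (\<lambda>x. E x - S J x) x = T E x - T (S J) x" for J
    by (rule linear_operator_on_diff(2)[OF T ED SD(1)])
  have elim: "e \<longlonglongrightarrow> 0"
  proof -
    have "(\<lambda>j. r ^ j / fact j) sums exp r"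
      using exp_converges[of r] by (simp add: divide_inverse mult.commute)
    then have "(\<lambda>J. exp r - (\<Sum>j<J. r ^ j / fact j)) \<longlonglongrightarrow> exp r - exp r"
      unfolding sums_def by (intro tendsto_diff tendsto_const)
    then show ?thesis by (simp add: e_def[abs_def])
  qed
  \<comment> \<open>The error \<open>E - S J\<close> is controlled uniformly by \<open>e J\<close>
    times \<bar>f\<bar>, so boundedness of \<open>T\<close> suffices; its image under
    \<open>T\<close> then vanishes pointwise along a subsequence.\<close>
  have Tlim: "(\<lambda>J. ?I (T (\<lambda>x. E x - S J x))) \<longlonglongrightarrow> 0"
  proof (rule squeeze_0_ennreal[where c = "K powr p" and b = "\<lambda>_. 0"])
    fix J
    have "?I (\<lambda>x. E x - S J x) \<le> ennreal (e J powr p) * ?I f"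
      by (rule nnLp_bounded_mult) (use p err e0 in auto)
    also have "\<dots> = ennreal (e J powr p * F)" using F by (simp add: ennreal_mult)
    finally have "ennreal (K powr p) * ?I (\<lambda>x. E x - S J x) \<le> ennreal (K powr p) * ennreal (e J powr p * F)"
      by (rule mult_left_mono) simp
    then show "?I (T (\<lambda>x. E x - S J x)) \<le> ennreal (K powr p) * (ennreal (e J powr p * F) + 0)"
      using bd[OF diffL[of J]] by simp
    have "(\<lambda>J. e J powr p * F) \<longlonglongrightarrow> 0 powr p * F"
      using p e0 by (intro tendsto_mult tendsto_powr' elim tendsto_const) auto
    then have "(\<lambda>J. ennreal (e J powr p * F)) \<longlonglongrightarrow> ennreal (0 powr p * F)"
      by (rule tendsto_ennrealI)
    then show "(\<lambda>J. ennreal (e J powr p * F)) \<longlonglongrightarrow> 0" by simp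
  qed simp
  have Tm: "T (\<lambda>x. E x - S J x) \<in> borel_measurable lebesgue" for J
    using diffL LpD L(5) by blast
  obtain q where q: "strict_mono q"
    "AE x in lebesgue. \<forall>i\<in>{()}. (\<lambda>n. T (\<lambda>x. E x - S (q n) x) x) \<longlonglongrightarrow> 0"
    by (rule nnLp_tendsto_0_AE_subseq[of "{()}" "\<lambda>_ J. T (\<lambda>x. E x - S J x)" lebesgue "\<lambda>x. 1" p])
      (use p Tm Tlim in auto)
  note q(2)
  moreover have "AE x in lebesgue. \<forall>J. T (\<lambda>x. E x - S J x) x = T E x - T (S J) x"
    using diffD by (simp add: AE_all_countable)
  moreover have "AE x in lebesgue. \<forall>J. T (S J) x = (\<Sum>j<J. (z ^ j / fact j) * T (B j) x)"
    using SD(2) by (simp add: AE_all_countable)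
  ultimately show ?thesis
  proof eventually_elim
    case (elim x)
    then obtain C where C: "\<And>j. norm (T (B j) x) \<le> C * (2 * N) ^ j" by auto
    define a where "a j = (z ^ j / fact j) * T (B j) x" for j
    define c where "c j = (- z * of_real (b x)) ^ j / fact j" for j
    have a: "summable (\<lambda>j. norm (a j))"
    proof (rule summable_comparison_test'[of "\<lambda>j. C * ((norm z * (2 * N)) ^ j / fact j)" 0])
      show "summable (\<lambda>j. C * ((norm z * (2 * N)) ^ j / fact j))"
        using summable_exp[of "norm z * (2 * N)"] by (intro summable_mult) (simp add: divide_inverse mult.commute)
      show "norm (norm (a j)) \<le> C * ((norm z * (2 * N)) ^ j / fact j)" if "j \<ge> 0" for j
      proof -
        have "norm (a j) = norm z ^ j / fact j * norm (T (B j) x)"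
          by (simp add: a_def norm_mult norm_divide norm_power)
        also have "\<dots> \<le> norm z ^ j / fact j * (C * (2 * N) ^ j)"
          by (rule mult_left_mono[OF C]) simp
        finally show ?thesis by (simp add: power_mult_distrib mult_ac)
      qed
    qed
    have c: "c sums exp (- z * of_real (b x))"
      using exp_converges[of "- z * of_real (b x)"] by (simp add: c_def[abs_def] scaleR_conv_of_real divide_inverse mult.commute)
    have cn: "summable (\<lambda>j. norm (c j))"
      using summable_norm_exp[of "- z * of_real (b x)"]
      by (simp add: c_def scaleR_conv_of_real divide_inverse mult.commute)
    have "(\<lambda>n. T E x - T (S (q n)) x) \<longlonglongrightarrow> 0" using elim by simp
    then have "(\<lambda>n. T E x - (T E x - T (S (q n)) x)) \<longlonglongrightarrow> T E x - 0"
      by (intro tendsto_diff tendsto_const)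
    then have "(\<lambda>n. \<Sum>j<q n. a j) \<longlonglongrightarrow> T E x" using elim by (simp add: a_def)
    moreover have "(\<lambda>n. \<Sum>j<q n. a j) \<longlonglongrightarrow> suminf a"
      using LIMSEQ_subseq_LIMSEQ[OF summable_LIMSEQ[OF summable_norm_cancel[OF a]] q(1)] by (simp add: o_def)
    \<comment> \<open>The full series converges by absolute summability, and the subsequence already
      has limit \<open>T E x\<close>; the two limits must agree.\<close>
    ultimately have sa: "suminf a = T E x" using LIMSEQ_unique by blast
    have "(\<lambda>k. \<Sum>i\<le>k. a i * c (k - i)) sums (T E x * exp (- z * of_real (b x)))"
      using Cauchy_product_sums[OF a cn] c sa by (simp add: sums_iff)
    moreover have "(\<Sum>i\<le>k. a i * c (k - i)) = z ^ k * (commutator T b k f x / fact k)" for k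
    proof -
      have "z ^ k * (commutator T b k f x / fact k) = (\<Sum>i\<le>k. z ^ k * (of_nat (k choose i) * (- of_real (b x)) ^ (k - i) * T (B i) x) / fact k)"
        unfolding commutator_eq_sum B_def by (simp add: sum_distrib_left sum_divide_distrib)
      also have "\<dots> = (\<Sum>i\<le>k. a i * c (k - i))"
      proof (rule sum.cong[OF refl])
        fix i assume "i \<in> {..k}"
        then have i: "i \<le> k" by simp
        have zk: "z ^ k = z ^ i * z ^ (k - i)" using i by (simp add: power_add[symmetric])
        have "(- z * of_real (b x)) ^ (k - i) = z ^ (k - i) * (- of_real (b x)) ^ (k - i)"
          by (simp only: power_mult_distrib[symmetric]) (simp add: mult.commute)
        then show "z ^ k * (of_nat (k choose i) * (- of_real (b x)) ^ (k - i) * T (B i) x) / fact k = a i * c (k - i)"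
          unfolding a_def c_def zk binomial_fact[OF i] by (simp add: field_simps)
      qed
      finally show ?thesis by simp
    qed
    ultimately show ?case by (simp add: E_def mult.commute)
  qed
qed

section \<open>Extension to weighted spaces\<close>

lemma Lp_limit_unique:
  assumes [measurable]: "\<And>n. u n \<in> borel_measurable M" "f \<in> borel_measurable M" "g \<in> borel_measurable M"
      "w \<in> borel_measurable M" and w0: "\<And>x. 0 < w x" and p: "1 \<le> p"
    and f: "(\<lambda>n. nnLp M p w (\<lambda>x. u n x - f x)) \<longlonglongrightarrow> 0"
    and g: "(\<lambda>n. nnLp M p w (\<lambda>x. u n x - g x)) \<longlonglongrightarrow> 0"
  shows "AE x in M. f x = g x"
proof -
  have le: "nnLp M p w (\<lambda>x. f x - g x) \<le>
      ennreal (2 powr p) * (nnLp M p w (\<lambda>x. u n x - g x) + nnLp M p w (\<lambda>x. u n x - f x))" for n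
    using nnLp_diff_le[of "\<lambda>x. u n x - g x" M "\<lambda>x. u n x - f x" w p] w0 p by (simp add: less_imp_le)
  have "(\<lambda>n::nat. nnLp M p w (\<lambda>x. f x - g x)) \<longlonglongrightarrow> 0"
    by (rule squeeze_0_ennreal[OF le g f])
  then have "nnLp M p w (\<lambda>x. f x - g x) = 0" by (simp add: LIMSEQ_const_iff)
  then have "AE x in M. f x - g x = 0"
    by (intro nnLp_eq_0_AE) (use w0 in auto)
  then show ?thesis by simp
qed

lemma Lp_limit_AE_subseq:
  fixes u :: "nat \<Rightarrow> 'a \<Rightarrow> complex"
  assumes [measurable]: "\<And>n. u n \<in> borel_measurable M" "f \<in> borel_measurable M"
      "w \<in> borel_measurable M" and w0: "\<And>x. 0 < w x" and p: "0 < p"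
    and f: "(\<lambda>n. nnLp M p w (\<lambda>x. u n x - f x)) \<longlonglongrightarrow> 0"
  obtains r where "strict_mono r" "AE x in M. (\<lambda>n. u (r n) x) \<longlonglongrightarrow> f x"
proof -
  obtain r where r: "strict_mono r" "AE x in M. \<forall>i\<in>{()}. (\<lambda>n. u (r n) x - f x) \<longlonglongrightarrow> 0"
    by (rule nnLp_tendsto_0_AE_subseq[of "{()}" "\<lambda>_ n x. u n x - f x" M w p]) (use assms in auto)
  from r(2) have "AE x in M. (\<lambda>n. u (r n) x) \<longlonglongrightarrow> f x"
    by eventually_elim (auto intro: LIM_zero_cancel)
  with r(1) that show thesis by blast
qed

text \<open>The pairs in \<open>P\<close> are a weight and the bound of \<open>T\<close> for it.  The approximants \<open>t n f\<close> of \<open>f\<close>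
  do not depend on the weight; this is what makes the extension the same for all of them.\<close>

lemma extend_operator:
  fixes T :: "(real ^ 'n \<Rightarrow> complex) \<Rightarrow> real ^ 'n \<Rightarrow> complex" and P :: "((real ^ 'n \<Rightarrow> real) \<times> real) set"
  assumes T: "linear_operator_on D T" and LpD: "Lp p (\<lambda>x. 1) \<subseteq> D" and p: "1 \<le> p"
    and P: "\<And>w C. (w, C) \<in> P \<Longrightarrow> w \<in> borel_measurable lebesgue" "\<And>w C x. (w, C) \<in> P \<Longrightarrow> 0 < w x"
    and bd: "\<And>w C f. (w, C) \<in> P \<Longrightarrow> f \<in> Lp p (\<lambda>x. 1) \<Longrightarrow> f \<in> Lp p w \<Longrightarrow>
      nnLp lebesgue p w (T f) \<le> ennreal (C powr p) * nnLp lebesgue p w f"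
  obtains S where
    "\<And>w C f. (w, C) \<in> P \<Longrightarrow> f \<in> Lp p (\<lambda>x. 1) \<Longrightarrow> f \<in> Lp p w \<Longrightarrow> AE x in lebesgue. S f x = T f x"
    "\<And>w C. (w, C) \<in> P \<Longrightarrow> linear_operator_on (Lp p w) S"
    "\<And>w C f. (w, C) \<in> P \<Longrightarrow> f \<in> Lp p w \<Longrightarrow>
      nnLp lebesgue p w (S f) \<le> ennreal (C powr p) * nnLp lebesgue p w f"
proof -
  note L = linear_operator_onD[OF T]
  let ?I = "nnLp lebesgue p"
  have P0: "0 \<le> w x" if "(w, C) \<in> P" for w C x using P(2)[OF that, of x] by simp
  have LpI: "f \<in> Lp p w \<longleftrightarrow> f \<in> borel_measurable lebesgue \<and> ?I w f < \<infinity>" if "(w, C) \<in> P" for f w C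
    by (rule Lp_iff_nnLp[OF P(1)[OF that] P0[OF that]])
  have w1: "(\<lambda>x::real^'n. 1::real) \<in> borel_measurable lebesgue" "\<And>x. (0::real) \<le> 1" by auto
  \<comment> \<open>Cutting off both in size and in space puts every truncation into the unweighted
    space, whichever weight \<open>f\<close> came with.\<close>
  define A where "A f n = {x. norm (f x) \<le> real n} \<inter> cball 0 (real n)" for f :: "real^'n \<Rightarrow> complex" and n
  define t where "t n f = (\<lambda>x. if x \<in> A f n then f x else 0)" for n f
  have Am[measurable]: "A f n \<in> sets lebesgue" if [measurable]: "f \<in> borel_measurable lebesgue" for f n
  proof -
    have "{x \<in> space lebesgue. norm (f x) \<le> real n} \<in> sets lebesgue" by measurable
    then show ?thesis by (auto simp: A_def)
  qed
  have tm[measurable]: "t n f \<in> borel_measurable lebesgue" if [measurable]: "f \<in> borel_measurable lebesgue" for f n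
    unfolding t_def by measurable
  have tle: "norm (t n f x) \<le> 1 * norm (f x)" for n f x by (simp add: t_def)
  have tL: "t n f \<in> Lp p w" if "(w, C) \<in> P" "f \<in> Lp p w" for n f w C
    by (rule Lp_bounded_mult[OF P(1)[OF that(1)] P0[OF that(1)] _ that(2) _ tle[of n f]])
      (use p tm[OF Lp_measurable[OF that(2)]] in auto)
  have tL1: "t n f \<in> Lp p (\<lambda>x. 1)" if f: "f \<in> borel_measurable lebesgue" for n f
  proof -
    have "?I (\<lambda>x. 1) (t n f) \<le> (\<integral>\<^sup>+x. ennreal (real n powr p) * indicator (cball 0 (real n) :: (real^'n) set) x \<partial>lebesgue)"
      unfolding nnLp_def
      by (rule nn_integral_mono) (use p in \<open>auto simp: t_def A_def indicator_def intro!: ennreal_leI powr_mono2\<close>)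
    also have "\<dots> = ennreal (real n powr p) * emeasure lebesgue (cball 0 (real n) :: (real^'n) set)"
      by (rule nn_integral_cmult_indicator) simp
    also have "\<dots> < \<infinity>"
      using fmeasurableD2[OF lmeasurable_cball, of "0 :: real^'n" "real n"]
      by (simp add: ennreal_mult_less_top less_top del: emeasure_completion)
    finally show ?thesis using tm[OF f] Lp_iff_nnLp[OF w1] by blast
  qed
  have tT[measurable]: "T (t n f) \<in> borel_measurable lebesgue" if "f \<in> borel_measurable lebesgue" for n f
    using L(5) LpD tL1[OF that] by blast
  have tlim: "(\<lambda>n. ?I w (\<lambda>x. t n f x - f x)) \<longlonglongrightarrow> 0" if w: "(w, C) \<in> P" and f: "f \<in> Lp p w" for w C f
    unfolding t_def
  proof (rule nnLp_truncate_tendsto_0)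
    show "\<forall>\<^sub>F n in sequentially. x \<in> A f n" for x
    proof -
      obtain m :: nat where m: "max (norm (f x)) (norm x) \<le> m" using real_arch_simple by blast
      have "\<forall>n\<ge>m. x \<in> A f n" using m by (auto simp: A_def)
      then show ?thesis by (auto simp: eventually_sequentially)
    qed
  qed (use f p LpI[OF w] P(1)[OF w] P0[OF w] Am in auto)
  have diff_bd: "?I w (\<lambda>x. T u x - T v x) \<le> ennreal (C powr p) * ?I w (\<lambda>x. u x - v x)"
    if w: "(w, C) \<in> P" and u: "u \<in> Lp p (\<lambda>x. 1)" "u \<in> Lp p w" and v: "v \<in> Lp p (\<lambda>x. 1)" "v \<in> Lp p w" for u v w C
  proof -
    have "AE x in lebesgue. T (\<lambda>x. u x - v x) x = T u x - T v x"
      by (rule linear_operator_on_diff(2)[OF T subsetD[OF LpD u(1)] subsetD[OF LpD v(1)]])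
    then have "?I w (\<lambda>x. T u x - T v x) = ?I w (T (\<lambda>x. u x - v x))"
      by (intro nnLp_cong_AE) auto
    also have "\<dots> \<le> ennreal (C powr p) * ?I w (\<lambda>x. u x - v x)"
      by (rule bd[OF w Lp_diff[OF w1 p u(1) v(1)] Lp_diff[OF P(1)[OF w] P0[OF w] p u(2) v(2)]])
    finally show ?thesis .
  qed
  define good where "good f h \<longleftrightarrow> h \<in> borel_measurable lebesgue \<and>
    (\<exists>w C. (w, C) \<in> P \<and> f \<in> Lp p w \<and> (\<lambda>n. ?I w (\<lambda>x. T (t n f) x - h x)) \<longlonglongrightarrow> 0)" for f h
  have ex: "\<exists>h. h \<in> borel_measurable lebesgue \<and> (\<lambda>n. ?I w (\<lambda>x. T (t n f) x - h x)) \<longlonglongrightarrow> 0"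
    if w: "(w, C) \<in> P" and f: "f \<in> Lp p w" for w C f
  proof -
    have fm[measurable]: "f \<in> borel_measurable lebesgue" by (rule Lp_measurable[OF f])
    obtain h where "h \<in> borel_measurable lebesgue" "(\<lambda>n. ?I w (\<lambda>x. T (t n f) x - h x)) \<longlonglongrightarrow> 0"
    proof (rule nnLp_complete[of "\<lambda>n. T (t n f)" lebesgue w p])
      fix e :: real assume e: "0 < e"
      define a where "a n = ennreal (C powr p * 2 powr p) * (?I w (\<lambda>x. t n f x - f x) + 0)" for n
      have "a \<longlonglongrightarrow> 0"
        unfolding a_def by (rule squeeze_0_ennreal[OF order_refl tlim[OF w f]]) simp
      then have "\<forall>\<^sub>F n in sequentially. a n < ennreal (e/2)"
        by (rule order_tendstoD(2)) (use e in simp)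
      then obtain N where N: "\<And>n. n \<ge> N \<Longrightarrow> a n < ennreal (e/2)" by (auto simp: eventually_sequentially)
      have "?I w (\<lambda>x. T (t m f) x - T (t n f) x) \<le> ennreal e" if mn: "m \<ge> N" "n \<ge> N" for m n
      proof -
        have "?I w (\<lambda>x. t m f x - t n f x) \<le> ennreal (2 powr p) * (?I w (\<lambda>x. t m f x - f x) + ?I w (\<lambda>x. t n f x - f x))"
          using nnLp_diff_le[of "\<lambda>x. t m f x - f x" lebesgue "\<lambda>x. t n f x - f x" w p] P[OF w] P0[OF w] p by simp
        then have "ennreal (C powr p) * ?I w (\<lambda>x. t m f x - t n f x) \<le>
          ennreal (C powr p) * (ennreal (2 powr p) * (?I w (\<lambda>x. t m f x - f x) + ?I w (\<lambda>x. t n f x - f x)))"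
          by (rule mult_left_mono) simp
        also have "\<dots> = a m + a n"
          by (simp add: a_def ennreal_mult distrib_left mult.assoc)
        also have "\<dots> \<le> ennreal (e/2) + ennreal (e/2)"
          using N mn by (intro add_mono less_imp_le) auto
        also have "\<dots> = ennreal e" using e by (simp add: ennreal_plus[symmetric] del: ennreal_plus)
        finally show ?thesis
          using diff_bd[OF w tL1 tL[OF w f] tL1 tL[OF w f], of m n] fm by simp
      qed
      then show "\<exists>N. \<forall>m\<ge>N. \<forall>n\<ge>N. ?I w (\<lambda>x. T (t m f) x - T (t n f) x) \<le> ennreal e" by blast
    qed (use P[OF w] p in auto)
    then show ?thesis by blast
  qed
  \<comment> \<open>Limits taken in different weighted spaces are compared by almost everywhere
    convergence, which no weight affects: a subsequence tends to \<open>h\<close>, and a further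
    subsequence of it to \<open>h'\<close>.\<close>
  have unique: "AE x in lebesgue. h x = h' x" if h: "good f h" and h': "good f h'" for f h h'
  proof -
    obtain w C where w: "(w, C) \<in> P" "f \<in> Lp p w" "(\<lambda>n. ?I w (\<lambda>x. T (t n f) x - h x)) \<longlonglongrightarrow> 0"
      using h by (auto simp: good_def)
    obtain w' C' where w': "(w', C') \<in> P" "f \<in> Lp p w'" "(\<lambda>n. ?I w' (\<lambda>x. T (t n f) x - h' x)) \<longlonglongrightarrow> 0"
      using h' by (auto simp: good_def)
    have [measurable]: "h \<in> borel_measurable lebesgue" "h' \<in> borel_measurable lebesgue"
      using h h' by (auto simp: good_def)
    have [measurable]: "f \<in> borel_measurable lebesgue" by (rule Lp_measurable[OF w(2)])
    obtain r where r: "strict_mono r" "AE x in lebesgue. (\<lambda>n. T (t (r n) f) x) \<longlonglongrightarrow> h x"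
      by (rule Lp_limit_AE_subseq[OF _ _ P(1)[OF w(1)] P(2)[OF w(1)] _ w(3)]) (use p in auto)
    have "(\<lambda>n. ?I w' (\<lambda>x. T (t (r n) f) x - h' x)) \<longlonglongrightarrow> 0"
      using LIMSEQ_subseq_LIMSEQ[OF w'(3) r(1)] by (simp add: o_def)
    then obtain s where s: "strict_mono s" "AE x in lebesgue. (\<lambda>n. T (t (r (s n)) f) x) \<longlonglongrightarrow> h' x"
      by (rule Lp_limit_AE_subseq[rotated 5, OF _ _ _ _ P(1)[OF w'(1)] P(2)[OF w'(1)]]) (use p in auto)
    from r(2) s(2) show ?thesis
    proof eventually_elim
      case (elim x)
      then show ?case using LIMSEQ_subseq_LIMSEQ[OF elim(1) s(1)] LIMSEQ_unique by (auto simp: o_def)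
    qed
  qed
  \<comment> \<open>The weight is hidden in the existential quantifier of \<open>good\<close>, so
    the choice depends on \<open>f\<close> alone; by \<open>unique\<close> it is correct for every
    weight whose space contains \<open>f\<close>.\<close>
  define S where "S f = (SOME h. good f h)" for f
  have S: "S f \<in> borel_measurable lebesgue" "(\<lambda>n. ?I w (\<lambda>x. T (t n f) x - S f x)) \<longlonglongrightarrow> 0"
    if w: "(w, C) \<in> P" and f: "f \<in> Lp p w" for w C f
  proof -
    obtain h where h: "h \<in> borel_measurable lebesgue" "(\<lambda>n. ?I w (\<lambda>x. T (t n f) x - h x)) \<longlonglongrightarrow> 0"
      using ex[OF w f] by blast
    then have gh: "good f h" using w f by (auto simp: good_def)
    then have gS: "good f (S f)" unfolding S_def by (rule someI[of "good f"])
    then show "S f \<in> borel_measurable lebesgue" by (simp add: good_def)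
    from unique[OF gS gh] have "?I w (\<lambda>x. T (t n f) x - S f x) = ?I w (\<lambda>x. T (t n f) x - h x)" for n
      by (intro nnLp_cong_AE) auto
    then show "(\<lambda>n. ?I w (\<lambda>x. T (t n f) x - S f x)) \<longlonglongrightarrow> 0" using h by simp
  qed
  \<comment> \<open>Arbitrary approximants must be allowed because truncation is not linear:
    \<open>t n f + t n g\<close> is in general not the truncation of the sum.\<close>
  have conv: "(\<lambda>n. ?I w (\<lambda>x. T (u n) x - S f x)) \<longlonglongrightarrow> 0"
    if w: "(w, C) \<in> P" and f: "f \<in> Lp p w" and u: "\<And>n. u n \<in> Lp p (\<lambda>x. 1)" "\<And>n. u n \<in> Lp p w"
      and lim: "(\<lambda>n. ?I w (\<lambda>x. u n x - f x)) \<longlonglongrightarrow> 0" for w C f and u :: "nat \<Rightarrow> real^'n \<Rightarrow> complex"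
  proof (rule squeeze_0_ennreal)
    have [measurable]: "f \<in> borel_measurable lebesgue" "\<And>n. u n \<in> borel_measurable lebesgue"
      by (rule Lp_measurable[OF f], rule Lp_measurable[OF u(2)])
    have [measurable]: "T (u n) \<in> borel_measurable lebesgue" for n using u LpD L(5) by blast
    note [measurable] = S(1)[OF w f] P(1)[OF w]
    show "?I w (\<lambda>x. T (u n) x - S f x) \<le> ennreal (2 powr p) *
        (?I w (\<lambda>x. T (u n) x - T (t n f) x) + ?I w (\<lambda>x. T (t n f) x - S f x))" for n
      using nnLp_add_le[of "\<lambda>x. T (u n) x - T (t n f) x" lebesgue "\<lambda>x. T (t n f) x - S f x" w p] P0[OF w] p by simp
    show "(\<lambda>n. ?I w (\<lambda>x. T (t n f) x - S f x)) \<longlonglongrightarrow> 0" by (rule S(2)[OF w f])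
    show "(\<lambda>n. ?I w (\<lambda>x. T (u n) x - T (t n f) x)) \<longlonglongrightarrow> 0"
    proof (rule squeeze_0_ennreal[OF _ lim tlim[OF w f]])
      fix n
      have "?I w (\<lambda>x. T (u n) x - T (t n f) x) \<le> ennreal (C powr p) * ?I w (\<lambda>x. u n x - t n f x)"
        by (rule diff_bd[OF w u tL1 tL[OF w f]]) simp
      also have "\<dots> \<le> ennreal (C powr p) * (ennreal (2 powr p) * (?I w (\<lambda>x. u n x - f x) + ?I w (\<lambda>x. t n f x - f x)))"
        using nnLp_diff_le[of "\<lambda>x. u n x - f x" lebesgue "\<lambda>x. t n f x - f x" w p] P0[OF w] p
        by (intro mult_left_mono) auto
      finally show "?I w (\<lambda>x. T (u n) x - T (t n f) x) \<le>
          ennreal (C powr p * 2 powr p) * (?I w (\<lambda>x. u n x - f x) + ?I w (\<lambda>x. t n f x - f x))"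
        by (simp add: ennreal_mult mult.assoc)
    qed
  qed
  show thesis
  proof (rule that)
    fix w C f assume w: "(w, C) \<in> P" and f1: "f \<in> Lp p (\<lambda>x. 1)" and f: "f \<in> Lp p w"
    have Tm: "T f \<in> borel_measurable lebesgue" using f1 LpD L(5) by blast
    have z: "?I w (\<lambda>x. 0) = 0" using p by (simp add: nnLp_def)
    \<comment> \<open>Here \<open>conv\<close> is applied to the constant sequence
      \<open>f\<close>.\<close>
    show "AE x in lebesgue. S f x = T f x"
      by (rule Lp_limit_unique[where u = "\<lambda>n. T f", OF _ S(1)[OF w f] _ P(1)[OF w] P(2)[OF w] _ conv[OF w f, of "\<lambda>_. f"]])
        (use p z Tm f f1 in simp_all)
  next
    fix w C f assume w: "(w, C) \<in> P" and f: "f \<in> Lp p w"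
    have [measurable]: "f \<in> borel_measurable lebesgue" by (rule Lp_measurable[OF f])
    obtain r where r: "strict_mono r" "AE x in lebesgue. (\<lambda>n. T (t (r n) f) x) \<longlonglongrightarrow> S f x"
      by (rule Lp_limit_AE_subseq[OF _ S(1)[OF w f] P(1)[OF w] P(2)[OF w] _ S(2)[OF w f]]) (use p in auto)
    show "?I w (S f) \<le> ennreal (C powr p) * ?I w f"
    proof (rule nnLp_Fatou[OF _ P(1)[OF w] _ r(2)])
      fix n
      have "?I w (T (t (r n) f)) \<le> ennreal (C powr p) * ?I w (t (r n) f)"
        by (rule bd[OF w tL1 tL[OF w f]]) simp
      also have "\<dots> \<le> ennreal (C powr p) * ?I w f"
        by (intro mult_left_mono nnLp_mono) (use P0[OF w] p in \<open>auto simp: t_def\<close>)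
      finally show "?I w (T (t (r n) f)) \<le> ennreal (C powr p) * ?I w f" .
    qed (use p in auto)
  next
    fix w C assume w: "(w, C) \<in> P"
    note I = LpI[OF w] and Pw[measurable] = P(1)[OF w]
    note addL = Lp_add[OF P(1)[OF w] P0[OF w] p] and addL1 = Lp_add[OF w1 p]
    have cL: "(\<lambda>x. c * f x) \<in> Lp p w" if "f \<in> Lp p w" for f c
      by (rule Lp_cmult[OF P(1)[OF w] P0[OF w] _ that]) (use p in simp)
    have cL1: "(\<lambda>x. c * f x) \<in> Lp p (\<lambda>x. 1)" if "f \<in> Lp p (\<lambda>x. 1)" for f :: "real^'n \<Rightarrow> complex" and c
      by (rule Lp_cmult[OF w1 _ that]) (use p in simp)
    show "linear_operator_on (Lp p w) S"
      unfolding linear_operator_on_def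
    proof (intro conjI ballI allI)
      show "Lp p w \<subseteq> borel_measurable lebesgue" using I by blast
      show "(\<lambda>x. 0) \<in> Lp p w" using p by (simp add: I nnLp_def)
      fix f assume f: "f \<in> Lp p w"
      have [measurable]: "f \<in> borel_measurable lebesgue" by (rule Lp_measurable[OF f])
      note [measurable] = S(1)[OF w f]
      show "S f \<in> borel_measurable lebesgue" by (rule S(1)[OF w f])
      {
        fix c
        show "(\<lambda>x. c * f x) \<in> Lp p w" by (rule cL[OF f])
        note [measurable] = S(1)[OF w this]
        have Tu: "AE x in lebesgue. T (\<lambda>x. c * t n f x) x = c * T (t n f) x" for n
          by (rule L(7)[OF subsetD[OF LpD tL1]]) simp
        have scale: "?I w (\<lambda>x. c * u x - c * v x) = ennreal (norm c powr p) * ?I w (\<lambda>x. u x - v x)"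
          if [measurable]: "u \<in> borel_measurable lebesgue" "v \<in> borel_measurable lebesgue" for u v
          using nnLp_cmult[of "\<lambda>x. u x - v x" lebesgue w p c] P0[OF w] by (simp add: right_diff_distrib)
        show "AE x in lebesgue. S (\<lambda>x. c * f x) x = c * S f x"
        proof (rule Lp_limit_unique[where u = "\<lambda>n. T (\<lambda>x. c * t n f x)" and w = w and p = p])
          show "(\<lambda>n. ?I w (\<lambda>x. T (\<lambda>x. c * t n f x) x - S (\<lambda>x. c * f x) x)) \<longlonglongrightarrow> 0"
          proof (rule conv[OF w cL[OF f] cL1[OF tL1] cL[OF tL[OF w f]]])
            show "(\<lambda>n. ?I w (\<lambda>x. c * t n f x - c * f x)) \<longlonglongrightarrow> 0"
              by (rule squeeze_0_ennreal[where c = "norm c powr p" and b = "\<lambda>_. 0", OF _ tlim[OF w f]]) (simp_all add: scale)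
          qed simp
          have eq: "?I w (\<lambda>x. T (\<lambda>x. c * t n f x) x - c * S f x) = ?I w (\<lambda>x. c * T (t n f) x - c * S f x)" for n
            by (rule nnLp_cong_AE) (use Tu[of n] in auto)
          show "(\<lambda>n. ?I w (\<lambda>x. T (\<lambda>x. c * t n f x) x - c * S f x)) \<longlonglongrightarrow> 0"
          proof (rule squeeze_0_ennreal[where c = "norm c powr p" and b = "\<lambda>_. 0", OF _ S(2)[OF w f]])
            show "?I w (\<lambda>x. T (\<lambda>x. c * t n f x) x - c * S f x) \<le>
                ennreal (norm c powr p) * (?I w (\<lambda>x. T (t n f) x - S f x) + 0)" for n
              unfolding eq by (subst scale) simp_all
          qed simp
          show "T (\<lambda>x. c * t n f x) \<in> borel_measurable lebesgue" for n
            by (rule L(5)[OF subsetD[OF LpD cL1[OF tL1]]]) simp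
        qed (use P[OF w] p in auto)
      }
      fix g assume g: "g \<in> Lp p w"
      show fg: "(\<lambda>x. f x + g x) \<in> Lp p w" by (rule addL[OF f g])
      have [measurable]: "g \<in> borel_measurable lebesgue" by (rule Lp_measurable[OF g])
      note [measurable] = S(1)[OF w g] S(1)[OF w fg]
      have Tu: "AE x in lebesgue. T (\<lambda>x. t n f x + t n g x) x = T (t n f) x + T (t n g) x" for n
        by (rule L(6)[OF subsetD[OF LpD tL1] subsetD[OF LpD tL1]]) simp_all
      have le: "?I w (\<lambda>x. u x + v x - (u' x + v' x)) \<le> ennreal (2 powr p) * (?I w (\<lambda>x. u x - u' x) + ?I w (\<lambda>x. v x - v' x))"
        if [measurable]: "u \<in> borel_measurable lebesgue" "v \<in> borel_measurable lebesgue"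
          "u' \<in> borel_measurable lebesgue" "v' \<in> borel_measurable lebesgue" for u v u' v'
        using nnLp_add_le[of "\<lambda>x. u x - u' x" lebesgue "\<lambda>x. v x - v' x" w p] P0[OF w] p by (simp add: algebra_simps)
      show "AE x in lebesgue. S (\<lambda>x. f x + g x) x = S f x + S g x"
      proof (rule Lp_limit_unique[where u = "\<lambda>n. T (\<lambda>x. t n f x + t n g x)" and w = w and p = p])
        show "(\<lambda>n. ?I w (\<lambda>x. T (\<lambda>x. t n f x + t n g x) x - S (\<lambda>x. f x + g x) x)) \<longlonglongrightarrow> 0"
        proof (rule conv[OF w fg addL1[OF tL1 tL1] addL[OF tL[OF w f] tL[OF w g]]])
          show "(\<lambda>n. ?I w (\<lambda>x. t n f x + t n g x - (f x + g x))) \<longlonglongrightarrow> 0"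
            by (rule squeeze_0_ennreal[OF le tlim[OF w f] tlim[OF w g]]) simp_all
        qed simp_all
        have eq: "?I w (\<lambda>x. T (\<lambda>x. t n f x + t n g x) x - (S f x + S g x)) =
            ?I w (\<lambda>x. T (t n f) x + T (t n g) x - (S f x + S g x))" for n
          by (rule nnLp_cong_AE) (use Tu[of n] in auto)
        show "(\<lambda>n. ?I w (\<lambda>x. T (\<lambda>x. t n f x + t n g x) x - (S f x + S g x))) \<longlonglongrightarrow> 0"
          unfolding eq by (rule squeeze_0_ennreal[OF le S(2)[OF w f] S(2)[OF w g]]) simp_all
        show "T (\<lambda>x. t n f x + t n g x) \<in> borel_measurable lebesgue" for n
          by (rule L(5)[OF subsetD[OF LpD addL1[OF tL1 tL1]]]) simp_all
      qed (use P[OF w] p in auto)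
    qed
  qed
qed

section \<open>Bounds for commutators and for weights\<close>

lemma BMO_measurable: "b \<in> BMO \<Longrightarrow> b \<in> borel_measurable lebesgue"
  by (simp add: BMO_def locally_integrable_def)

lemma bmo_norm_nonneg: "0 \<le> bmo_norm b"
  by (simp add: bmo_norm_def)

text \<open>Adding 1 to the norm in the denominator keeps the exponent positive when the norm is 0.
  The minus sign is that of the decaying weight.\<close>

lemma obtain_admissible:
  assumes l0: "0 < l0"
  obtains d where "0 < d" "bmo_norm b = 0 \<or> \<bar>- d\<bar> \<le> l0 / bmo_norm b"
proof
  show "0 < l0 / (bmo_norm b + 1)"
    using l0 bmo_norm_nonneg[of b] by (simp add: add_nonneg_pos)
  show "bmo_norm b = 0 \<or> \<bar>- (l0 / (bmo_norm b + 1))\<bar> \<le> l0 / bmo_norm b"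
    using l0 bmo_norm_nonneg[of b] by (cases "bmo_norm b = 0") (auto intro!: divide_left_mono)
qed

lemma ennreal_powr_mult_assoc:
  "ennreal (a powr p) * (ennreal (b powr p) * X) = ennreal ((a * b) powr p) * X"
  by (simp add: mult.assoc[symmetric] ennreal_mult[symmetric] powr_mult)

lemma power_le_exp:
  assumes "0 \<le> (t::real)" "0 < s"
  shows "t ^ j \<le> fact j / s ^ j * exp (s * t)"
proof -
  have e: "(\<lambda>j. (s * t) ^ j / fact j) sums exp (s * t)"
    using exp_converges[of "s * t"] by (simp add: divide_inverse mult.commute)
  have "sum (\<lambda>j. (s * t) ^ j / fact j) {j} \<le> suminf (\<lambda>j. (s * t) ^ j / fact j)"
    by (rule sum_le_suminf[OF sums_summable[OF e]]) (use assms in auto)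
  then have "(s * t) ^ j / fact j \<le> exp (s * t)"
    using sums_unique[OF e] by simp
  then show ?thesis using assms by (simp add: power_mult_distrib field_simps)
qed

lemma nnLp_exp_real:
  assumes "0 < p"
  shows "nnLp M p (\<lambda>x. exp (u x)) f = nnLp M p (\<lambda>x. 1) (\<lambda>x. exp (of_real (u x / p)) * f x)"
  using nnLp_exp_weight[of M p "\<lambda>x. 1" "\<lambda>x. of_real (u x / p)" f] assms by simp

text \<open>The p-th root of the weight, exp(- d \<bar>b\<bar> / p), absorbs every power of
  \<bar>b\<bar>. So a single weight holds all the products \<open>b^j f\<close>, for any positive
  \<open>d\<close>.\<close>

lemma Lp_power_weight:
  assumes f: "f \<in> Lp p (\<lambda>x. 1)" and [measurable]: "b \<in> borel_measurable lebesgue" and d: "0 < d" and p: "1 \<le> p"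
  shows "(\<lambda>x. of_real (b x) ^ j * f x) \<in> Lp p (\<lambda>x. exp (- d * \<bar>b x\<bar>))"
proof -
  have [measurable]: "f \<in> borel_measurable lebesgue" by (rule Lp_measurable[OF f])
  let ?g = "\<lambda>x. of_real (b x) ^ j * f x"
  have "nnLp lebesgue p (\<lambda>x. exp (- d * \<bar>b x\<bar>)) ?g
      = nnLp lebesgue p (\<lambda>x. 1) (\<lambda>x. exp (of_real (- d * \<bar>b x\<bar> / p)) * ?g x)"
    by (rule nnLp_exp_real) (use p in simp)
  also have "\<dots> \<le> ennreal ((fact j / (d / p) ^ j) powr p) * nnLp lebesgue p (\<lambda>x. 1) f"
  proof (rule nnLp_bounded_mult)
    fix x
    have "exp (- d * \<bar>b x\<bar> / p) * \<bar>b x\<bar> ^ j \<le> exp (- d * \<bar>b x\<bar> / p) * (fact j / (d / p) ^ j * exp (d / p * \<bar>b x\<bar>))"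
      by (intro mult_left_mono power_le_exp) (use d p in auto)
    also have "\<dots> = fact j / (d / p) ^ j"
      by (simp add: exp_minus field_simps)
    finally have "exp (- d * \<bar>b x\<bar> / p) * \<bar>b x\<bar> ^ j * norm (f x) \<le> fact j / (d / p) ^ j * norm (f x)"
      by (rule mult_right_mono) simp
    then show "norm (exp (of_real (- d * \<bar>b x\<bar> / p)) * ?g x) \<le> fact j / (d / p) ^ j * norm (f x)"
      by (simp add: norm_mult norm_power mult.assoc)
  qed (use p d in auto)
  also have "\<dots> < \<infinity>"
    using f[unfolded Lp_iff_nnLp[OF borel_measurable_const zero_le_one]] by (simp add: ennreal_mult_less_top)
  finally show ?thesis
    by (subst Lp_iff_nnLp) auto
qed

text \<open>The Cauchy estimate applies to the coefficients \<open>T_b^k f / k!\<close>, and the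
  factorial is restored at the end. The conclusion is free of \<open>N\<close>.\<close>

lemma commutator_bound_of_conjugates:
  fixes T :: "(real ^ 'n \<Rightarrow> complex) \<Rightarrow> real ^ 'n \<Rightarrow> complex"
  assumes T: "linear_operator_on D T" and LpD: "Lp p (\<lambda>x. 1) \<subseteq> D" and p: "1 \<le> p" and K: "0 \<le> K"
    and bd: "\<And>g. g \<in> Lp p (\<lambda>x. 1) \<Longrightarrow>
      nnLp lebesgue p (\<lambda>x. 1) (T g) \<le> ennreal (K powr p) * nnLp lebesgue p (\<lambda>x. 1) g"
    and b[measurable]: "b \<in> borel_measurable lebesgue" and f: "f \<in> Lp p (\<lambda>x. 1)"
    and bN: "\<And>x. f x \<noteq> 0 \<Longrightarrow> \<bar>b x\<bar> \<le> N" and N: "0 < N" and e: "0 < e"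
    and conj: "\<And>z. norm z = e \<Longrightarrow> nnLp lebesgue p (\<lambda>x. 1)
      (\<lambda>x. exp (- z * of_real (b x)) * T (\<lambda>y. exp (z * of_real (b y)) * f y) x) \<le> B"
  shows "nnLp lebesgue p (\<lambda>x. 1) (commutator T b k f) \<le> ennreal ((fact k / e ^ k) powr p) * B"
proof -
  let ?I = "nnLp lebesgue p (\<lambda>x::real^'n. 1)"
  have w1: "(\<lambda>x::real^'n. 1::real) \<in> borel_measurable lebesgue" "\<And>x. (0::real) \<le> 1" by auto
  have dom: "f \<in> commutator_dom D b n" for n
    unfolding commutator_dom_iff
    using Lp_power_mult[OF w1 _ f b bN] LpD p N by auto
  have cm[measurable]: "commutator T b n f \<in> borel_measurable lebesgue" for n
    by (rule commutator_measurable[OF T dom b])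
  have Tm[measurable]: "T (\<lambda>y. exp (z * of_real (b y)) * f y) \<in> borel_measurable lebesgue" for z
    using Lp_exp_mult[OF w1 _ f b bN, of z] LpD p linear_operator_onD(5)[OF T] by auto
  have "?I (\<lambda>x. commutator T b k f x / fact k) \<le> ennreal ((1 / e ^ k) powr p) * B"
    by (rule nnLp_Cauchy_estimate[OF _ _ w1 p e
        commutator_power_series[OF T LpD p K bd b f bN N] conj, where k = k]) simp_all
  then have "ennreal (norm (fact k :: complex) powr p) * ?I (\<lambda>x. commutator T b k f x / fact k)
      \<le> ennreal (fact k powr p) * (ennreal ((1 / e ^ k) powr p) * B)"
    unfolding norm_fact by (rule mult_left_mono) simp
  moreover have "?I (\<lambda>x. fact k * (commutator T b k f x / fact k))
      = ennreal (norm (fact k :: complex) powr p) * ?I (\<lambda>x. commutator T b k f x / fact k)"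
    by (rule nnLp_cmult) simp_all
  ultimately have "?I (commutator T b k f) \<le> ennreal (fact k powr p) * (ennreal ((1 / e ^ k) powr p) * B)"
    by simp
  also have "\<dots> = ennreal ((fact k / e ^ k) powr p) * B"
    unfolding ennreal_powr_mult_assoc by simp
  finally show ?thesis .
qed

text \<open>The radius \<open>e\<close> stays free: when the norm of \<open>b\<close> is 0 every
  radius is allowed, and the best bound comes from letting it grow.\<close>

lemma commutator_bound:
  fixes T :: "(real ^ 'n \<Rightarrow> complex) \<Rightarrow> real ^ 'n \<Rightarrow> complex"
  assumes T: "linear_operator_on D T" and LpD: "Lp p (\<lambda>x. 1) \<subseteq> D" and p: "1 \<le> p" and l0: "0 < l0" and C: "0 \<le> C"
    and bd: "\<And>b l g. b \<in> BMO \<Longrightarrow> bmo_norm b = 0 \<or> \<bar>l\<bar> \<le> l0 / bmo_norm b \<Longrightarrow> g \<in> D \<Longrightarrow> g \<in> Lp p (\<lambda>x. exp (l * b x)) \<Longrightarrow>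
      nnLp lebesgue p (\<lambda>x. exp (l * b x)) (T g) \<le> ennreal (C powr p) * nnLp lebesgue p (\<lambda>x. exp (l * b x)) g"
    and b: "b \<in> BMO" and e: "0 < e" "e * p * bmo_norm b \<le> l0"
    and f: "f \<in> Lp p (\<lambda>x. 1)" and fD: "f \<in> commutator_dom D b k"
  shows "nnLp lebesgue p (\<lambda>x. 1) (commutator T b k f) \<le>
    ennreal ((C * (fact k / e ^ k)) powr p) * nnLp lebesgue p (\<lambda>x. 1) f"
proof -
  let ?I = "nnLp lebesgue p (\<lambda>x::real^'n. 1)"
  have w1: "(\<lambda>x::real^'n. 1::real) \<in> borel_measurable lebesgue" "\<And>x. (0::real) \<le> 1" by auto
  note L = linear_operator_onD[OF T]
  have bm[measurable]: "b \<in> borel_measurable lebesgue" by (rule BMO_measurable[OF b])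
  have fm[measurable]: "f \<in> borel_measurable lebesgue" by (rule Lp_measurable[OF f])
  have bd1: "?I (T g) \<le> ennreal (C powr p) * ?I g" if "g \<in> Lp p (\<lambda>x. 1)" for g
    using bd[OF zero_BMO, of 0 g] that LpD bmo_norm_zero by auto
  define A where "A n = {x. \<bar>b x\<bar> \<le> real (Suc n)}" for n
  define F where "F n = (\<lambda>x. if x \<in> A n then f x else 0)" for n
  have Am[measurable]: "A n \<in> sets lebesgue" for n
  proof -
    have "{x \<in> space lebesgue. \<bar>b x\<bar> \<le> real (Suc n)} \<in> sets lebesgue" by measurable
    then show ?thesis by (simp add: A_def)
  qed
  have Fm[measurable]: "F n \<in> borel_measurable lebesgue" for n unfolding F_def by measurable
  have FL: "F n \<in> Lp p (\<lambda>x. 1)" for n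
    by (rule Lp_bounded_mult[OF w1 _ f Fm, where c = 1]) (use p in \<open>auto simp: F_def\<close>)
  have FN: "\<bar>b x\<bar> \<le> real (Suc n)" if "F n x \<noteq> 0" for n x
    using that by (auto simp: F_def A_def split: if_splits)
  have FD: "F n \<in> commutator_dom D b k" for n
    unfolding commutator_dom_iff using Lp_power_mult[OF w1 _ FL bm FN] LpD p by auto
  have Np: "0 < real (Suc n)" for n by simp
  have bound: "?I (commutator T b k (F n)) \<le> ennreal ((C * (fact k / e ^ k)) powr p) * ?I f" for n
  proof -
    have "?I (commutator T b k (F n)) \<le> ennreal ((fact k / e ^ k) powr p) * (ennreal (C powr p) * ?I f)"
    proof (rule commutator_bound_of_conjugates[OF T LpD p C bd1 bm FL FN Np e(1)])
      fix z :: complex assume z: "norm z = e"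
      \<comment> \<open>The conjugate at \<open>z\<close> has as its norm the norm of
        \<open>T\<close> with weight exp(l b), and in that weight exp(z b) F has exactly the
        unweighted norm of F. On the circle \<bar>l\<bar> \<le> \<open>e * p\<close>, so
        \<open>l\<close> is admissible.\<close>
      define l where "l = - (p * Re z)"
      have w: "(\<lambda>x. 1 * exp (p * Re (- z * of_real (b x)))) = (\<lambda>x. exp (l * b x))"
        by (simp add: l_def mult_ac)
      have w': "(\<lambda>x. exp (l * b x) * exp (p * Re (z * of_real (b x)))) = (\<lambda>x. 1)"
        by (simp add: l_def exp_add[symmetric] mult_ac)
      let ?g = "\<lambda>y. exp (z * of_real (b y)) * F n y"
      have g1: "?g \<in> Lp p (\<lambda>x. 1)" using Lp_exp_mult[OF w1 _ FL bm FN] p by simp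
      have gI: "nnLp lebesgue p (\<lambda>x. exp (l * b x)) ?g = ?I (F n)"
        unfolding nnLp_exp_weight[symmetric] w' ..
      have gw: "?g \<in> Lp p (\<lambda>x. exp (l * b x))"
        using FL[of n, unfolded Lp_iff_nnLp[OF w1]] Lp_measurable[OF g1] by (subst Lp_iff_nnLp) (simp_all add: gI)
      have "\<bar>l\<bar> \<le> e * p"
        using abs_Re_le_cmod[of z] z p by (simp add: l_def abs_mult mult.commute mult_left_mono)
      then have "bmo_norm b = 0 \<or> \<bar>l\<bar> \<le> l0 / bmo_norm b"
        using order_trans[OF mult_right_mono[OF _ bmo_norm_nonneg[of b]] e(2)] bmo_norm_nonneg[of b]
        by (cases "bmo_norm b = 0") (auto simp: pos_le_divide_eq)
      note c = this
      have "?I (\<lambda>x. exp (- z * of_real (b x)) * T ?g x) = nnLp lebesgue p (\<lambda>x. exp (l * b x)) (T ?g)"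
        unfolding nnLp_exp_weight[symmetric] w ..
      also have "\<dots> \<le> ennreal (C powr p) * nnLp lebesgue p (\<lambda>x. exp (l * b x)) ?g"
        by (rule bd[OF b c subsetD[OF LpD g1] gw])
      also have "\<dots> = ennreal (C powr p) * ?I (F n)" by (simp only: gI)
      also have "\<dots> \<le> ennreal (C powr p) * ?I f"
        by (intro mult_left_mono nnLp_mono) (use p in \<open>auto simp: F_def\<close>)
      finally show "?I (\<lambda>x. exp (- z * of_real (b x)) * T ?g x) \<le> ennreal (C powr p) * ?I f" .
    qed
    also have "\<dots> = ennreal ((C * (fact k / e ^ k)) powr p) * ?I f"
      unfolding ennreal_powr_mult_assoc by (simp only: mult.commute)
    finally show ?thesis .
  qed
  obtain d where d: "0 < d" and dc: "bmo_norm (\<lambda>x. \<bar>b x\<bar>) = 0 \<or> \<bar>- d\<bar> \<le> l0 / bmo_norm (\<lambda>x. \<bar>b x\<bar>)"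
    by (rule obtain_admissible[OF l0])
  let ?w = "\<lambda>x. exp (- d * \<bar>b x\<bar>)"
  have wm: "?w \<in> borel_measurable lebesgue" and wp: "0 < ?w x" and w0: "0 \<le> ?w x" for x by auto
  define B where "B j = (\<lambda>y. of_real (b y) ^ j * f y)" for j
  define G where "G j n = (\<lambda>y. of_real (b y) ^ j * F n y)" for j n
  have BD: "B j \<in> D" and GD: "G j n \<in> D" if "j \<le> k" for j n
    using that fD FD by (auto simp: commutator_dom_iff B_def G_def)
  have BL: "B j \<in> Lp p ?w" for j unfolding B_def by (rule Lp_power_weight[OF f bm d p])
  have GL: "G j n \<in> Lp p ?w" for j n unfolding G_def by (rule Lp_power_weight[OF FL bm d p])
  have G_alt: "G j n = (\<lambda>x. if x \<in> A n then B j x else 0)" for j n by (auto simp: G_def B_def F_def)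
  have diff: "AE x in lebesgue. T (\<lambda>x. G j n x - B j x) x = T (G j n) x - T (B j) x" if "j \<le> k" for j n
    by (rule linear_operator_on_diff(2)[OF T GD[OF that] BD[OF that]])
  have diffD: "(\<lambda>x. G j n x - B j x) \<in> D" if "j \<le> k" for j n
    by (rule linear_operator_on_diff(1)[OF T GD[OF that] BD[OF that]])
  \<comment> \<open>Each \<open>b^j f\<close> is approximated by its own cut-off in the space with
    weight \<open>?w\<close>, where the hypothesis applied to \<bar>b\<bar> bounds
    \<open>T\<close>.\<close>
  have lim: "(\<lambda>n. nnLp lebesgue p ?w (T (\<lambda>x. G j n x - B j x))) \<longlonglongrightarrow> 0" if j: "j \<le> k" for j
  proof (rule squeeze_0_ennreal[where c = "C powr p" and b = "\<lambda>_. 0"])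
    show "nnLp lebesgue p ?w (T (\<lambda>x. G j n x - B j x))
        \<le> ennreal (C powr p) * (nnLp lebesgue p ?w (\<lambda>x. G j n x - B j x) + 0)" for n
      using bd[OF abs_BMO[OF b] dc diffD[OF j, of n] Lp_diff[OF wm w0 p GL BL]] by simp
    show "(\<lambda>n. nnLp lebesgue p ?w (\<lambda>x. G j n x - B j x)) \<longlonglongrightarrow> 0"
      unfolding G_alt
    proof (rule nnLp_truncate_tendsto_0[OF Lp_measurable[OF BL] wm Am w0])
      show "nnLp lebesgue p ?w (B j) < \<infinity>" using BL[of j, unfolded Lp_iff_nnLp[OF wm w0]] by blast
      show "\<forall>\<^sub>F n in sequentially. x \<in> A n" for x
      proof -
        obtain m :: nat where m: "\<bar>b x\<bar> \<le> m" using real_arch_simple by blast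
        have "\<forall>n\<ge>m. x \<in> A n" using m by (auto simp: A_def)
        then show ?thesis by (auto simp: eventually_sequentially)
      qed
    qed (use p in simp)
  qed simp
  have Tdm: "T (\<lambda>x. G j n x - B j x) \<in> borel_measurable lebesgue" if "j \<le> k" for j n
    by (rule L(5)[OF diffD[OF that]])
  \<comment> \<open>One subsequence for all \<open>j \<le> k\<close> gives pointwise convergence of
    the commutators, and Fatou then returns to the unweighted norm.\<close>
  obtain r where r: "strict_mono r"
    "AE x in lebesgue. \<forall>j\<in>{..k}. (\<lambda>n. T (\<lambda>x. G j (r n) x - B j x) x) \<longlonglongrightarrow> 0"
    by (rule nnLp_tendsto_0_AE_subseq[of "{..k}" "\<lambda>j n. T (\<lambda>x. G j n x - B j x)" lebesgue ?w p])
      (use Tdm wm p lim in auto)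
  have "AE x in lebesgue. \<forall>j\<in>{..k}. \<forall>n. T (\<lambda>x. G j n x - B j x) x = T (G j n) x - T (B j) x"
    unfolding AE_all_countable AE_finite_all[OF finite_atMost] using diff by auto
  with r(2) have "AE x in lebesgue. (\<lambda>n. commutator T b k (F (r n)) x) \<longlonglongrightarrow> commutator T b k f x"
  proof eventually_elim
    case (elim x)
    have "(\<lambda>n. T (G j (r n)) x) \<longlonglongrightarrow> T (B j) x" if "j \<le> k" for j
      by (rule LIM_zero_cancel) (use elim that in auto)
    then show ?case
      unfolding commutator_eq_sum G_def B_def by (intro tendsto_sum tendsto_mult tendsto_const) auto
  qed
  then show ?thesis
    by (rule nnLp_Fatou[OF commutator_measurable[OF T FD bm] w1(1) _ _ bound, rotated]) (use p in simp)
qed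

text \<open>The ratio \<open>\<rho>\<close> of the geometric series is taken strictly between \<open>\<bar>l\<bar> B / l0\<close> and \<open>1\<close>
  rather than equal to \<open>\<bar>l\<bar> B / l0\<close>, so that it is nonzero also when \<open>l = 0\<close> or \<open>B = 0\<close>; this costs
  the factor \<open>2\<close>.\<close>

lemma weighted_bound_truncated:
  fixes T :: "(real ^ 'n \<Rightarrow> complex) \<Rightarrow> real ^ 'n \<Rightarrow> complex"
  assumes T: "linear_operator_on D T" and LpD: "Lp p (\<lambda>x. 1) \<subseteq> D" and p: "1 \<le> p" and l0: "0 < l0" and C: "0 < C"
    and bd: "\<And>k f. f \<in> Lp p (\<lambda>x. 1) \<Longrightarrow> f \<in> commutator_dom D b k \<Longrightarrow>
      nnLp lebesgue p (\<lambda>x. 1) (commutator T b k f) \<le>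
        ennreal ((C * fact k * (p / l0) ^ k * B ^ k) powr p) * nnLp lebesgue p (\<lambda>x. 1) f"
    and b[measurable]: "b \<in> borel_measurable lebesgue" and f: "f \<in> Lp p (\<lambda>x. 1)"
    and bN: "\<And>x. f x \<noteq> 0 \<Longrightarrow> \<bar>b x\<bar> \<le> N" and N: "0 < N" and B: "0 \<le> B" "\<bar>l\<bar> * B < l0"
  shows "nnLp lebesgue p (\<lambda>x. exp (l * b x)) (T f) \<le>
    ennreal ((2 * C / (1 - \<bar>l\<bar> * B / l0)) powr p) * nnLp lebesgue p (\<lambda>x. exp (l * b x)) f"
proof -
  let ?I = "nnLp lebesgue p (\<lambda>x::real^'n. 1)"
  have w1: "(\<lambda>x::real^'n. 1::real) \<in> borel_measurable lebesgue" "\<And>x. (0::real) \<le> 1" by auto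
  \<comment> \<open>With this \<open>z\<close> the weighted norm of a function is the unweighted
    norm of exp(- z b) times it. Hence \<open>g\<close> carries the weighted norm of
    \<open>f\<close>, and exp(z b) g is \<open>f\<close> again.\<close>
  define z where "z = complex_of_real (- l / p)"
  define g where "g = (\<lambda>x. exp (- z * of_real (b x)) * f x)"
  define t where "t = \<bar>l\<bar> * B / l0"
  define \<rho> where "\<rho> = (1 + t) / 2"
  have t: "0 \<le> t" "t < 1" using B l0 by (auto simp: t_def)
  have \<rho>: "0 < \<rho>" "\<rho> < 1" "t \<le> \<rho>" using t by (auto simp: \<rho>_def)
  have g1: "g \<in> Lp p (\<lambda>x. 1)"
    unfolding g_def by (rule Lp_exp_mult[OF w1 _ f b bN]) (use p in auto)
  have gN: "\<bar>b x\<bar> \<le> N" if "g x \<noteq> 0" for x using that bN by (auto simp: g_def)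
  have gD: "g \<in> commutator_dom D b k" for k
    unfolding commutator_dom_iff using Lp_power_mult[OF w1 _ g1 b gN] LpD p N by auto
  have gf: "(\<lambda>y. exp (z * of_real (b y)) * g y) = f"
    by (simp add: g_def exp_minus fun_eq_iff)
  have bd1: "?I (T h) \<le> ennreal (C powr p) * ?I h" if "h \<in> Lp p (\<lambda>x. 1)" for h
    using bd[of h 0] that LpD by auto
  have cm: "commutator T b k g \<in> borel_measurable lebesgue" for k
    by (rule commutator_measurable[OF T gD b])
  have w: "nnLp lebesgue p (\<lambda>x. exp (l * b x)) h = ?I (\<lambda>x. exp (- z * of_real (b x)) * h x)" for h
    using nnLp_exp_real[of p lebesgue "\<lambda>x. l * b x" h] p by (simp add: z_def)
  \<comment> \<open>Normalised so that the k-th term of the series is \<open>\<rho> ^ k\<close>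
    times a function whose norm is at most \<open>C\<close> times that of \<open>g\<close>. In the
    check, the modulus \<bar>l\<bar> / p of \<open>z\<close> cancels the power of \<open>p\<close>
    in the commutator bound.\<close>
  define a where "a k = z ^ k / (fact k * of_real \<rho> ^ k)" for k
  have series: "AE x in lebesgue. (\<lambda>k. of_real (\<rho> ^ k) * (a k * commutator T b k g x)) sums
      (exp (- z * of_real (b x)) * T f x)"
  proof -
    have "AE x in lebesgue. (\<lambda>k. z ^ k * (commutator T b k g x / fact k)) sums
        (exp (- z * of_real (b x)) * T (\<lambda>y. exp (z * of_real (b y)) * g y) x)"
      by (rule commutator_power_series[OF T LpD p less_imp_le[OF C] bd1 b g1 gN N])
    then show ?thesis
      unfolding gf by eventually_elim (use \<rho> in \<open>simp add: a_def\<close>)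
  qed
  have norm_a: "norm (a k) * (C * fact k * (p / l0) ^ k * B ^ k) \<le> C" for k
  proof -
    have "norm (a k) * (C * fact k * (p / l0) ^ k * B ^ k) = C * (t / \<rho>) ^ k"
      using \<rho> p by (simp add: a_def z_def t_def norm_divide norm_mult norm_power power_mult_distrib power_divide mult_ac)
    also have "\<dots> \<le> C * 1"
      using \<rho> t C by (intro mult_left_mono power_le_one) (auto simp: divide_le_eq)
    finally show ?thesis by simp
  qed
  have "?I (\<lambda>x. exp (- z * of_real (b x)) * T f x) \<le> ennreal ((\<Sum>k. \<rho> ^ k) powr p) * (ennreal (C powr p) * ?I g)"
  proof (rule nnLp_sums_le[OF _ w1 p _ _ _ series])
    fix k
    show "(\<lambda>x. a k * commutator T b k g x) \<in> borel_measurable lebesgue" using cm by measurable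
    have "?I (\<lambda>x. a k * commutator T b k g x) = ennreal (norm (a k) powr p) * ?I (commutator T b k g)"
      by (rule nnLp_cmult[OF cm w1])
    also have "\<dots> \<le> ennreal (norm (a k) powr p) * (ennreal ((C * fact k * (p / l0) ^ k * B ^ k) powr p) * ?I g)"
      by (intro mult_left_mono bd[OF g1 gD]) simp
    also have "\<dots> = ennreal ((norm (a k) * (C * fact k * (p / l0) ^ k * B ^ k)) powr p) * ?I g"
      by (rule ennreal_powr_mult_assoc)
    also have "\<dots> \<le> ennreal (C powr p) * ?I g"
      using norm_a[of k] p C l0 B by (intro mult_right_mono ennreal_leI powr_mono2) auto
    finally show "?I (\<lambda>x. a k * commutator T b k g x) \<le> ennreal (C powr p) * ?I g" .
  qed (use \<rho> in auto)
  also have "(\<Sum>k. \<rho> ^ k) = 2 / (1 - t)"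
    using \<rho> t by (simp add: suminf_geometric) (simp add: \<rho>_def field_simps)
  also have "ennreal ((2 / (1 - t)) powr p) * (ennreal (C powr p) * ?I g) = ennreal ((2 / (1 - t) * C) powr p) * ?I g"
    by (rule ennreal_powr_mult_assoc)
  finally show ?thesis by (simp add: w g_def t_def)
qed

text \<open>The truncated bound has a constant independent of the cut-off. Convergence of
  \<open>T (F n)\<close> takes place in the unweighted space, and Fatou transfers the weighted
  estimate, whose right side may be infinite.\<close>

lemma weighted_bound:
  fixes T :: "(real ^ 'n \<Rightarrow> complex) \<Rightarrow> real ^ 'n \<Rightarrow> complex"
  assumes T: "linear_operator_on D T" and LpD: "Lp p (\<lambda>x. 1) \<subseteq> D" and p: "1 \<le> p" and l0: "0 < l0" and C: "0 < C"
    and bd: "\<And>k f. f \<in> Lp p (\<lambda>x. 1) \<Longrightarrow> f \<in> commutator_dom D b k \<Longrightarrow>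
      nnLp lebesgue p (\<lambda>x. 1) (commutator T b k f) \<le>
        ennreal ((C * fact k * (p / l0) ^ k * B ^ k) powr p) * nnLp lebesgue p (\<lambda>x. 1) f"
    and b[measurable]: "b \<in> borel_measurable lebesgue" and f: "f \<in> Lp p (\<lambda>x. 1)"
    and B: "0 \<le> B" "\<bar>l\<bar> * B < l0"
  shows "nnLp lebesgue p (\<lambda>x. exp (l * b x)) (T f) \<le>
    ennreal ((2 * C / (1 - \<bar>l\<bar> * B / l0)) powr p) * nnLp lebesgue p (\<lambda>x. exp (l * b x)) f"
proof -
  let ?I = "nnLp lebesgue p (\<lambda>x::real^'n. 1)"
  have w1: "(\<lambda>x::real^'n. 1::real) \<in> borel_measurable lebesgue" "\<And>x. (0::real) \<le> 1" by auto
  note L = linear_operator_onD[OF T]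
  have fm[measurable]: "f \<in> borel_measurable lebesgue" by (rule Lp_measurable[OF f])
  define A where "A n = {x. \<bar>b x\<bar> \<le> real (Suc n)}" for n
  define F where "F n = (\<lambda>x. if x \<in> A n then f x else 0)" for n
  have Am[measurable]: "A n \<in> sets lebesgue" for n
  proof -
    have "{x \<in> space lebesgue. \<bar>b x\<bar> \<le> real (Suc n)} \<in> sets lebesgue" by measurable
    then show ?thesis by (simp add: A_def)
  qed
  have Fm[measurable]: "F n \<in> borel_measurable lebesgue" for n unfolding F_def by measurable
  have FL: "F n \<in> Lp p (\<lambda>x. 1)" for n
    by (rule Lp_bounded_mult[OF w1 _ f Fm, where c = 1]) (use p in \<open>auto simp: F_def\<close>)
  have FN: "\<bar>b x\<bar> \<le> real (Suc n)" if "F n x \<noteq> 0" for n x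
    using that by (auto simp: F_def A_def split: if_splits)
  have bd1: "?I (T h) \<le> ennreal (C powr p) * ?I h" if "h \<in> Lp p (\<lambda>x. 1)" for h
    using bd[of h 0] that LpD by auto
  have lim: "(\<lambda>n. ?I (\<lambda>x. T (F n) x - T f x)) \<longlonglongrightarrow> 0"
  proof (rule squeeze_0_ennreal[where c = "C powr p" and b = "\<lambda>_. 0"])
    fix n
    have "?I (\<lambda>x. T (F n) x - T f x) = ?I (T (\<lambda>x. F n x - f x))"
      by (rule nnLp_cong_AE)
        (use linear_operator_on_diff(2)[OF T subsetD[OF LpD FL[of n]] subsetD[OF LpD f]] in auto)
    also have "\<dots> \<le> ennreal (C powr p) * ?I (\<lambda>x. F n x - f x)"
      by (rule bd1[OF Lp_diff[OF w1 p FL f]])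
    finally show "?I (\<lambda>x. T (F n) x - T f x) \<le> ennreal (C powr p) * (?I (\<lambda>x. F n x - f x) + 0)" by simp
    show "(\<lambda>n. ?I (\<lambda>x. F n x - f x)) \<longlonglongrightarrow> 0"
      unfolding F_def
    proof (rule nnLp_truncate_tendsto_0[OF fm w1(1) Am w1(2)])
      show "?I f < \<infinity>" using f[unfolded Lp_iff_nnLp[OF w1]] by blast
      show "\<forall>\<^sub>F n in sequentially. x \<in> A n" for x
      proof -
        obtain m :: nat where m: "\<bar>b x\<bar> \<le> m" using real_arch_simple by blast
        have "\<forall>n\<ge>m. x \<in> A n" using m by (auto simp: A_def)
        then show ?thesis by (auto simp: eventually_sequentially)
      qed
    qed (use p in simp)
  qed simp
  have TF: "T (F n) \<in> borel_measurable lebesgue" for n by (rule L(5)[OF subsetD[OF LpD FL]])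
  obtain r where r: "strict_mono r" "AE x in lebesgue. (\<lambda>n. T (F (r n)) x) \<longlonglongrightarrow> T f x"
    by (rule Lp_limit_AE_subseq[OF TF L(5)[OF subsetD[OF LpD f]] w1(1) _ _ lim]) (use p in auto)
  show ?thesis
  proof (rule nnLp_Fatou[OF TF _ _ r(2)])
    fix n
    have "nnLp lebesgue p (\<lambda>x. exp (l * b x)) (T (F (r n))) \<le>
        ennreal ((2 * C / (1 - \<bar>l\<bar> * B / l0)) powr p) * nnLp lebesgue p (\<lambda>x. exp (l * b x)) (F (r n))"
      by (rule weighted_bound_truncated[OF T LpD p l0 C bd b FL FN _ B]) simp_all
    also have "\<dots> \<le> ennreal ((2 * C / (1 - \<bar>l\<bar> * B / l0)) powr p) * nnLp lebesgue p (\<lambda>x. exp (l * b x)) f"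
      by (intro mult_left_mono nnLp_mono) (use p in \<open>auto simp: F_def\<close>)
    finally show "nnLp lebesgue p (\<lambda>x. exp (l * b x)) (T (F (r n))) \<le>
        ennreal ((2 * C / (1 - \<bar>l\<bar> * B / l0)) powr p) * nnLp lebesgue p (\<lambda>x. exp (l * b x)) f" .
  qed (use p in auto)
qed

text \<open>All products \<open>b^j f\<close> lie in one space with weight exp(- d \<bar>b\<bar>),
  admissible through \<bar>b\<bar>. So the commutators are defined on all of the unweighted space
  once \<open>D\<close> contains the weighted ones.\<close>

lemma Lp_subset_commutator_dom:
  fixes b :: "real ^ 'n \<Rightarrow> real"
  assumes l0: "0 < l0" and p: "1 < p" and b: "b \<in> BMO"
    and D: "\<And>(b :: real ^ 'n \<Rightarrow> real) l. b \<in> BMO \<Longrightarrow> bmo_norm b = 0 \<or> \<bar>l\<bar> \<le> l0 / bmo_norm b \<Longrightarrow>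
      Lp p (\<lambda>x. exp (l * b x)) \<subseteq> D"
  shows "Lp p (\<lambda>x. 1) \<subseteq> commutator_dom D b k"
proof
  fix f :: "real ^ 'n \<Rightarrow> complex" assume f: "f \<in> Lp p (\<lambda>x. 1)"
  obtain d where d: "0 < d" "bmo_norm (\<lambda>x. \<bar>b x\<bar>) = 0 \<or> \<bar>- d\<bar> \<le> l0 / bmo_norm (\<lambda>x. \<bar>b x\<bar>)"
    by (rule obtain_admissible[OF l0])
  show "f \<in> commutator_dom D b k"
    unfolding commutator_dom_iff
    using Lp_power_weight[OF f BMO_measurable[OF b] d(1), of _] D[OF abs_BMO[OF b] d(2)] p by auto
qed

section \<open>The two directions as operator bounds\<close>

lemma commutator_Lp_bound_on:
  fixes T :: "(real ^ 'n \<Rightarrow> complex) \<Rightarrow> real ^ 'n \<Rightarrow> complex"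
  assumes p: "1 < p" and T: "linear_operator_on D T" and LpD: "Lp p (\<lambda>x. 1) \<subseteq> D"
    and l0: "0 < l0" and \<phi>: "\<phi> \<in> {0..l0} \<rightarrow> {0..}" "mono_on {0..l0} \<phi>"
    and H: "\<And>b l. b \<in> BMO \<Longrightarrow> bmo_norm b = 0 \<or> \<bar>l\<bar> \<le> l0 / bmo_norm b \<Longrightarrow>
      Lp_bound_on D T p (\<lambda>x. exp (l * b x)) (\<phi> (\<bar>l\<bar> * bmo_norm b))"
    and b: "b \<in> BMO"
  shows "Lp_bound_on (commutator_dom D b k) (commutator T b k) p (\<lambda>x. 1)
    (\<phi> l0 * fact k * (p / l0) ^ k * bmo_norm b ^ k)"
proof -
  let ?I = "nnLp lebesgue p (\<lambda>x::real^'n. 1)"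
  have w1: "(\<lambda>x::real^'n. 1::real) \<in> borel_measurable lebesgue" "\<And>x. (0::real) \<le> 1" by auto
  have C: "0 \<le> \<phi> l0" using \<phi>(1) l0 by auto
  have bd: "nnLp lebesgue p (\<lambda>x. exp (l * b x)) (T g) \<le> ennreal (\<phi> l0 powr p) * nnLp lebesgue p (\<lambda>x. exp (l * b x)) g"
    if b: "b \<in> BMO" and l: "bmo_norm b = 0 \<or> \<bar>l\<bar> \<le> l0 / bmo_norm b" and g: "g \<in> D" "g \<in> Lp p (\<lambda>x. exp (l * b x))" for b l g
  proof -
    have t: "0 \<le> \<bar>l\<bar> * bmo_norm b" "\<bar>l\<bar> * bmo_norm b \<le> l0"
      using l l0 bmo_norm_nonneg[of b] by (cases "bmo_norm b = 0"; auto simp: pos_le_divide_eq)+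
    then have \<phi>t: "0 \<le> \<phi> (\<bar>l\<bar> * bmo_norm b)" "\<phi> (\<bar>l\<bar> * bmo_norm b) \<le> \<phi> l0"
      using \<phi>(1) mono_onD[OF \<phi>(2), of "\<bar>l\<bar> * bmo_norm b" l0] l0 by auto
    have "nnLp lebesgue p (\<lambda>x. exp (l * b x)) (T g)
        \<le> ennreal (\<phi> (\<bar>l\<bar> * bmo_norm b) powr p) * nnLp lebesgue p (\<lambda>x. exp (l * b x)) g"
      by (rule Lp_bound_onD(2)[OF H[OF b l] g]) (use p \<phi>t in auto)
    also have "\<dots> \<le> ennreal (\<phi> l0 powr p) * nnLp lebesgue p (\<lambda>x. exp (l * b x)) g"
      using p \<phi>t by (intro mult_right_mono ennreal_leI powr_mono2) auto
    finally show ?thesis .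
  qed
  have e: "?I (commutator T b k f) \<le> ennreal ((\<phi> l0 * (fact k / e ^ k)) powr p) * ?I f"
    if "f \<in> commutator_dom D b k" "f \<in> Lp p (\<lambda>x. 1)" "0 < e" "e * p * bmo_norm b \<le> l0" for f e
    by (rule commutator_bound[OF T LpD _ l0 C bd b that(3,4,2,1)]) (use p in auto)
  show ?thesis
  proof (rule Lp_bound_onI[OF w1])
    show "0 \<le> \<phi> l0 * fact k * (p / l0) ^ k * bmo_norm b ^ k"
      using C p l0 bmo_norm_nonneg[of b] by simp
    fix f assume f: "f \<in> commutator_dom D b k" "f \<in> Lp p (\<lambda>x. 1)"
    show "commutator T b k f \<in> borel_measurable lebesgue"
      by (rule commutator_measurable[OF T f(1) BMO_measurable[OF b]])
    show "?I (commutator T b k f) \<le> ennreal ((\<phi> l0 * fact k * (p / l0) ^ k * bmo_norm b ^ k) powr p) * ?I f"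
    proof (cases "bmo_norm b = 0")
      case False
      then have B: "0 < bmo_norm b" using bmo_norm_nonneg[of b] by simp
      \<comment> \<open>The largest admissible radius is \<open>l0 / (p * bmo_norm b)\<close>, which
        gives exactly the claimed constant.\<close>
      have "\<phi> l0 * (fact k / (l0 / (p * bmo_norm b)) ^ k) = \<phi> l0 * fact k * (p / l0) ^ k * bmo_norm b ^ k"
        using p l0 B by (simp add: power_divide power_mult_distrib)
      then show ?thesis using e[OF f, of "l0 / (p * bmo_norm b)"] p l0 B by simp
    next
      case B: True
      show ?thesis
      \<comment> \<open>For \<open>k = 0\<close> the factor \<open>bmo_norm b ^ k\<close> is 1 and
        the claim bounds \<open>T\<close> itself. For larger \<open>k\<close> the claimed constant
        is 0, and the radii \<open>Suc n\<close>, all admissible, force the norm of the commutator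
        down to 0.\<close>
      proof (cases "k = 0")
        case True
        then show ?thesis using e[OF f, of 1] B l0 by simp
      next
        case False
        obtain F where F: "?I f = ennreal F" "0 \<le> F"
          using f(2)[unfolded Lp_iff_nnLp[OF w1]] by (cases "?I f") auto
        have "?I (commutator T b k f) \<le> ennreal (((\<phi> l0 * fact k) * inverse (real (Suc n))) powr p * F)" for n
        proof -
          have "real (Suc n) ^ 1 \<le> real (Suc n) ^ k"
            using False by (intro power_increasing) auto
          then have "fact k / real (Suc n) ^ k \<le> fact k * inverse (real (Suc n))"
            by (simp add: divide_inverse le_imp_inverse_le)
          then have "\<phi> l0 * (fact k / real (Suc n) ^ k) \<le> \<phi> l0 * fact k * inverse (real (Suc n))"
            using mult_left_mono[OF _ C] by (metis mult.assoc)
          then have "(\<phi> l0 * (fact k / real (Suc n) ^ k)) powr p \<le> (\<phi> l0 * fact k * inverse (real (Suc n))) powr p"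
            using p C by (intro powr_mono2) auto
          then have "ennreal ((\<phi> l0 * (fact k / real (Suc n) ^ k)) powr p) * ?I f
              \<le> ennreal ((\<phi> l0 * fact k * inverse (real (Suc n))) powr p) * ?I f"
            by (intro mult_right_mono ennreal_leI) auto
          then show ?thesis
            using e[OF f, of "real (Suc n)"] B l0 F(2) unfolding F(1) by (simp add: ennreal_mult)
        qed
        moreover have "(\<lambda>n. ennreal (((\<phi> l0 * fact k) * inverse (real (Suc n))) powr p * F)) \<longlonglongrightarrow> ennreal (0 powr p * F)"
        proof (intro tendsto_ennrealI tendsto_mult tendsto_powr' tendsto_const)
          show "(\<lambda>n. \<phi> l0 * fact k * inverse (real (Suc n))) \<longlonglongrightarrow> 0"
            by (rule tendsto_mult_right_zero[OF LIMSEQ_inverse_real_of_nat])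
        qed (use p C in auto)
        ultimately have "?I (commutator T b k f) \<le> ennreal (0 powr p * F)"
          by (intro LIMSEQ_le_const) auto
        then show ?thesis by simp
      qed
    qed
  qed (use p in auto)
qed

lemma weighted_extension:
  fixes T :: "(real ^ 'n \<Rightarrow> complex) \<Rightarrow> real ^ 'n \<Rightarrow> complex"
  assumes p: "1 < p" and T: "linear_operator_on D T" and LpD: "Lp p (\<lambda>x. 1) \<subseteq> D"
    and l0: "0 < l0" and C0: "0 < C0"
    and H: "\<And>b k. b \<in> BMO \<Longrightarrow> Lp_bound_on (commutator_dom D b k) (commutator T b k) p (\<lambda>x. 1)
      (C0 * fact k * (p / l0) ^ k * bmo_norm b ^ k)"
  shows "\<exists>\<phi> :: real \<Rightarrow> real. \<phi> \<in> {0..<l0} \<rightarrow> {0..} \<and> mono_on {0..<l0} \<phi> \<and>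
      (\<forall>b\<in>BMO. \<forall>l. bmo_norm b = 0 \<or> \<bar>l\<bar> < l0 / bmo_norm b \<longrightarrow>
         Lp_bound_on (Lp p (\<lambda>x. 1)) T p (\<lambda>x. exp (l * b x)) (\<phi> (\<bar>l\<bar> * bmo_norm b))) \<and>
      (\<exists>S. (\<forall>f \<in> Lp p (\<lambda>x. 1). AE x in lebesgue. S f x = T f x) \<and>
         (\<forall>b\<in>BMO. \<forall>l. bmo_norm b = 0 \<or> \<bar>l\<bar> < l0 / bmo_norm b \<longrightarrow>
            linear_operator_on (Lp p (\<lambda>x. exp (l * b x))) S \<and>
            Lp_bound_on (Lp p (\<lambda>x. exp (l * b x))) S p (\<lambda>x. exp (l * b x)) (\<phi> (\<bar>l\<bar> * bmo_norm b))))"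
proof -
  \<comment> \<open>The constant of \<open>weighted_bound\<close> as a function of \<bar>l\<bar>
    times the norm of \<open>b\<close>. It blows up at \<open>l0\<close>, whence the half-open
    interval.\<close>
  define \<phi> where "\<phi> t = 2 * C0 / (1 - t / l0)" for t
  define adm where "adm b l \<longleftrightarrow> b \<in> BMO \<and> (bmo_norm b = 0 \<or> \<bar>l\<bar> < l0 / bmo_norm b)" for b :: "real^'n \<Rightarrow> real" and l
  \<comment> \<open>The extension is made for all admissible weights at once, so that the same
    \<open>S\<close> serves each of them.\<close>
  define P where "P = {(\<lambda>x. exp (l * b x), \<phi> (\<bar>l\<bar> * bmo_norm b)) | b l. adm b l}"
  have t: "\<bar>l\<bar> * bmo_norm b < l0" if "adm b l" for b l
    using that l0 bmo_norm_nonneg[of b] by (cases "bmo_norm b = 0") (auto simp: adm_def pos_less_divide_eq)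
  have \<phi>0: "0 \<le> \<phi> (\<bar>l\<bar> * bmo_norm b)" if "adm b l" for b l
    using t[OF that] l0 C0 by (auto simp: \<phi>_def)
  have wm: "(\<lambda>x. exp (l * b x)) \<in> borel_measurable lebesgue" if "adm b l" for b l
    using BMO_measurable[of b] that by (auto simp: adm_def)
  have bound: "nnLp lebesgue p (\<lambda>x. exp (l * b x)) (T f)
      \<le> ennreal (\<phi> (\<bar>l\<bar> * bmo_norm b) powr p) * nnLp lebesgue p (\<lambda>x. exp (l * b x)) f"
    if a: "adm b l" and f: "f \<in> Lp p (\<lambda>x. 1)" for b l f
  proof -
    have b: "b \<in> BMO" using a by (simp add: adm_def)
    show ?thesis
      unfolding \<phi>_def
    proof (rule weighted_bound[OF T LpD _ l0 C0 _ BMO_measurable[OF b] f bmo_norm_nonneg t[OF a]])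
      fix k g assume "g \<in> Lp p (\<lambda>x. 1)" "g \<in> commutator_dom D b k"
      then show "nnLp lebesgue p (\<lambda>x. 1) (commutator T b k g)
          \<le> ennreal ((C0 * fact k * (p / l0) ^ k * bmo_norm b ^ k) powr p) * nnLp lebesgue p (\<lambda>x. 1) g"
        by (intro Lp_bound_onD(2)[OF H[OF b]]) (use p l0 C0 bmo_norm_nonneg[of b] in auto)
    qed (use p in simp)
  qed
  obtain S where
    S1: "\<And>w C f. (w, C) \<in> P \<Longrightarrow> f \<in> Lp p (\<lambda>x. 1) \<Longrightarrow> f \<in> Lp p w \<Longrightarrow> AE x in lebesgue. S f x = T f x" and
    S2: "\<And>w C. (w, C) \<in> P \<Longrightarrow> linear_operator_on (Lp p w) S" and
    S3: "\<And>w C f. (w, C) \<in> P \<Longrightarrow> f \<in> Lp p w \<Longrightarrow>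
      nnLp lebesgue p w (S f) \<le> ennreal (C powr p) * nnLp lebesgue p w f"
  proof (rule extend_operator[OF T LpD, of P])
    show "1 \<le> p" using p by simp
    show "w \<in> borel_measurable lebesgue" if "(w, C) \<in> P" for w C
      using that wm by (auto simp: P_def)
    show "0 < w x" if "(w, C) \<in> P" for w C x
      using that by (auto simp: P_def)
    show "nnLp lebesgue p w (T f) \<le> ennreal (C powr p) * nnLp lebesgue p w f"
      if "(w, C) \<in> P" "f \<in> Lp p (\<lambda>x. 1)" for w C f
      using that bound by (auto simp: P_def)
  qed blast
  have PI: "(\<lambda>x. exp (l * b x), \<phi> (\<bar>l\<bar> * bmo_norm b)) \<in> P" if "adm b l" for b l
    using that by (auto simp: P_def)
  \<comment> \<open>The weight 1 is among those in \<open>P\<close>; through it \<open>S\<close>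
    agrees with \<open>T\<close> on the whole unweighted space.\<close>
  have one: "adm (\<lambda>x. 0) 0" by (simp add: adm_def zero_BMO bmo_norm_zero)
  have "\<phi> \<in> {0..<l0} \<rightarrow> {0..}"
    using l0 C0 by (auto simp: \<phi>_def)
  moreover have "mono_on {0..<l0} \<phi>"
  proof (rule mono_onI)
    fix r s assume "r \<in> {0..<l0}" "s \<in> {0..<l0}" "r \<le> s"
    then show "\<phi> r \<le> \<phi> s"
      unfolding \<phi>_def using l0 C0 by (intro divide_left_mono mult_pos_pos) (auto simp: divide_right_mono)
  qed
  moreover have "Lp_bound_on (Lp p (\<lambda>x. 1)) T p (\<lambda>x. exp (l * b x)) (\<phi> (\<bar>l\<bar> * bmo_norm b))"
    if a: "adm b l" for b l
  proof (rule Lp_bound_onI[OF wm[OF a] _ _ \<phi>0[OF a] _ bound[OF a]])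
    show "T f \<in> borel_measurable lebesgue" if "f \<in> Lp p (\<lambda>x. 1)" for f
      using that LpD linear_operator_onD(5)[OF T] by blast
  qed (use p in auto)
  moreover have "AE x in lebesgue. S f x = T f x" if "f \<in> Lp p (\<lambda>x. 1)" for f
    using S1[OF PI[OF one] that] that by simp
  moreover have "linear_operator_on (Lp p (\<lambda>x. exp (l * b x))) S"
      "Lp_bound_on (Lp p (\<lambda>x. exp (l * b x))) S p (\<lambda>x. exp (l * b x)) (\<phi> (\<bar>l\<bar> * bmo_norm b))"
    if a: "adm b l" for b l
  proof -
    show lin: "linear_operator_on (Lp p (\<lambda>x. exp (l * b x))) S" by (rule S2[OF PI[OF a]])
    show "Lp_bound_on (Lp p (\<lambda>x. exp (l * b x))) S p (\<lambda>x. exp (l * b x)) (\<phi> (\<bar>l\<bar> * bmo_norm b))"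
      by (rule Lp_bound_onI[OF wm[OF a] _ _ \<phi>0[OF a] linear_operator_onD(5)[OF lin] S3[OF PI[OF a]]]) (use p in auto)
  qed
  ultimately show ?thesis
    by (intro exI[of _ \<phi>] conjI exI[of _ S] ballI allI impI) (simp_all add: adm_def)
qed

text \<open>The alternative \<open>bmo_norm b = 0\<close> renders the void restriction, as a
  quotient by 0 would be 0. In (a) the commutator bound concerns functions for which each term is
  defined, and the added inclusion tells when these are all of the unweighted space. In (b) nothing
  places the weighted spaces inside \<open>D\<close>, so beyond the unweighted space the bound is
  for one extension \<open>S\<close> common to all admissible weights.\<close>

theorem theorem3p29:
  fixes p :: real
    and D :: "(real ^ 'n \<Rightarrow> complex) set"
    and T :: "(real ^ 'n \<Rightarrow> complex) \<Rightarrow> real ^ 'n \<Rightarrow> complex"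
  assumes "1 < p"
    and "linear_operator_on D T"
    and "Lp p (\<lambda>x. 1) \<subseteq> D"
  shows
    "(\<forall>l0 (\<phi> :: real \<Rightarrow> real).
        0 < l0 \<and> \<phi> \<in> {0..l0} \<rightarrow> {0..} \<and> mono_on {0..l0} \<phi> \<and>
        (\<forall>b\<in>BMO. \<forall>l. bmo_norm b = 0 \<or> \<bar>l\<bar> \<le> l0 / bmo_norm b \<longrightarrow>
           Lp_bound_on D T p (\<lambda>x. exp (l * b x)) (\<phi> (\<bar>l\<bar> * bmo_norm b)))
      \<longrightarrow>
        (\<forall>k. \<forall>b\<in>BMO.
           Lp_bound_on (commutator_dom D b k) (commutator T b k) p (\<lambda>x. 1)
             (\<phi> l0 * fact k * (p / l0) ^ k * bmo_norm b ^ k)) \<and>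
        ((\<forall>b\<in>BMO. \<forall>l. bmo_norm b = 0 \<or> \<bar>l\<bar> \<le> l0 / bmo_norm b \<longrightarrow>
            Lp p (\<lambda>x. exp (l * b x)) \<subseteq> D)
         \<longrightarrow> (\<forall>k. \<forall>b\<in>BMO. Lp p (\<lambda>x. 1) \<subseteq> commutator_dom D b k)))
   \<and>
     (\<forall>l0 C0.
        0 < l0 \<and> 0 < C0 \<and>
        (\<forall>b\<in>BMO. \<forall>k.
           Lp_bound_on (commutator_dom D b k) (commutator T b k) p (\<lambda>x. 1)
             (C0 * fact k * (p / l0) ^ k * bmo_norm b ^ k))
      \<longrightarrow>
        (\<exists>\<phi> :: real \<Rightarrow> real. \<phi> \<in> {0..<l0} \<rightarrow> {0..} \<and> mono_on {0..<l0} \<phi> \<and>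
           (\<forall>b\<in>BMO. \<forall>l. bmo_norm b = 0 \<or> \<bar>l\<bar> < l0 / bmo_norm b \<longrightarrow>
              Lp_bound_on (Lp p (\<lambda>x. 1)) T p (\<lambda>x. exp (l * b x)) (\<phi> (\<bar>l\<bar> * bmo_norm b))) \<and>
           (\<exists>S. (\<forall>f \<in> Lp p (\<lambda>x. 1). AE x in lebesgue. S f x = T f x) \<and>
              (\<forall>b\<in>BMO. \<forall>l. bmo_norm b = 0 \<or> \<bar>l\<bar> < l0 / bmo_norm b \<longrightarrow>
                 linear_operator_on (Lp p (\<lambda>x. exp (l * b x))) S \<and>
                 Lp_bound_on (Lp p (\<lambda>x. exp (l * b x))) S p (\<lambda>x. exp (l * b x))
                   (\<phi> (\<bar>l\<bar> * bmo_norm b))))))"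
proof (intro conjI allI impI; (elim conjE)?)
  fix l0 :: real and \<phi> :: "real \<Rightarrow> real" and k and b :: "real ^ 'n \<Rightarrow> real"
  assume l0: "0 < l0" and \<phi>: "\<phi> \<in> {0..l0} \<rightarrow> {0..}" "mono_on {0..l0} \<phi>"
    and H: "\<forall>b\<in>BMO. \<forall>l. bmo_norm b = 0 \<or> \<bar>l\<bar> \<le> l0 / bmo_norm b \<longrightarrow>
      Lp_bound_on D T p (\<lambda>x. exp (l * b x)) (\<phi> (\<bar>l\<bar> * bmo_norm b))"
  show "\<forall>b\<in>BMO. Lp_bound_on (commutator_dom D b k) (commutator T b k) p (\<lambda>x. 1)
      (\<phi> l0 * fact k * (p / l0) ^ k * bmo_norm b ^ k)"
    by (rule ballI, rule commutator_Lp_bound_on[OF assms(1-3) l0 \<phi>]) (use H in auto)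
next
  fix l0 :: real and \<phi> :: "real \<Rightarrow> real" and k
  assume "0 < l0" "\<forall>b\<in>BMO. \<forall>l. bmo_norm b = 0 \<or> \<bar>l\<bar> \<le> l0 / bmo_norm b \<longrightarrow> Lp p (\<lambda>x. exp (l * b x)) \<subseteq> D"
  then show "\<forall>b\<in>BMO. Lp p (\<lambda>x. 1) \<subseteq> commutator_dom D b k"
    by (intro ballI Lp_subset_commutator_dom[of l0]) (use assms(1) in auto)
next
  fix l0 C0 :: real
  assume "0 < l0" "0 < C0" and H: "\<forall>b\<in>BMO. \<forall>k. Lp_bound_on (commutator_dom D b k) (commutator T b k) p (\<lambda>x. 1)
      (C0 * fact k * (p / l0) ^ k * bmo_norm b ^ k)"
  show "\<exists>\<phi> :: real \<Rightarrow> real. \<phi> \<in> {0..<l0} \<rightarrow> {0..} \<and> mono_on {0..<l0} \<phi> \<and>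
      (\<forall>b\<in>BMO. \<forall>l. bmo_norm b = 0 \<or> \<bar>l\<bar> < l0 / bmo_norm b \<longrightarrow>
         Lp_bound_on (Lp p (\<lambda>x. 1)) T p (\<lambda>x. exp (l * b x)) (\<phi> (\<bar>l\<bar> * bmo_norm b))) \<and>
      (\<exists>S. (\<forall>f \<in> Lp p (\<lambda>x. 1). AE x in lebesgue. S f x = T f x) \<and>
         (\<forall>b\<in>BMO. \<forall>l. bmo_norm b = 0 \<or> \<bar>l\<bar> < l0 / bmo_norm b \<longrightarrow>
            linear_operator_on (Lp p (\<lambda>x. exp (l * b x))) S \<and>
            Lp_bound_on (Lp p (\<lambda>x. exp (l * b x))) S p (\<lambda>x. exp (l * b x)) (\<phi> (\<bar>l\<bar> * bmo_norm b))))"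
    by (rule weighted_extension[OF assms(1-3) \<open>0 < l0\<close> \<open>0 < C0\<close>]) (use H in auto)
qed

end
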